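(* Let $\mathcal X,\mathcal Y,\tilde{\mathcal X},\tilde{\mathcal Y}$ be finite sets, let $p(x)$ be a pmf on $\mathcal X$, let $p(y|x)$ and $p(\tilde y|\tilde x)$ be discrete memoryless channels from $\mathcal X$ to $\mathcal Y$ and from $\tilde{\mathcal X}$ to $\tilde{\mathcal Y}$ respectively, and let $R\ge 0$. The pair $(p(x),p(y|x))$ is in the admissible region of the channel-rate pair $(p(\tilde y|\tilde x),R)$ for the asymptotic average-case model if there exist a finite-valued auxiliary random variable $U$ and channels $p(u,\tilde x|x)$ and $p(y|\tilde y,u)$ such that the joint pmf $$p(u,\tilde x,\tilde y,x,y)=p(x)\,p(u,\tilde x|x)\,p(\tilde y|\tilde x)\,p(y|\tilde y,u)$$ has the given marginal $p(x,y)=p(x)p(y|x)$ on $(X,Y)$ and satisfies $$R+I(U;\tilde Y)>I(U;XY),\qquad I(U;\tilde Y)>I(U;X).$$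
   Context: All random variables take values in finite sets. Logarithms are base 2. Average-case channel simulation: the goal is to simulate memoryless copies of $p(y|x)$ using memoryless copies of $p(\tilde y|\tilde x)$. $X^n$ is i.i.d. with pmf $p(x)$. The shared randomness $\omega$ is independent of $X^n$ and uniformly distributed on $[1:2^{nR}]=\{1,\dots,2^{nR}\}$ (with $2^{nR}$ understood as an integer, e.g. rounded down). A simulation code of length $n$ consists of a stochastic encoder $q^{\mathrm{enc}}(\tilde x^n|x^n,\omega)$ and a stochastic decoder $q^{\mathrm{dec}}(y^n|\tilde y^n,\omega)$. It induces the distribution $$q(\tilde x^n,\tilde y^n,y^n|\omega,x^n)=q^{\mathrm{enc}}(\tilde x^n|x^n,\omega)\Big(\prod_{i=1}^n p(\tilde y_i|\tilde x_i)\Big)q^{\mathrm{dec}}(y^n|\tilde y^n,\omega),$$ and $q(x^n,y^n)$ denotes the resulting marginal on $(X^n,Y^n)$. It is an $(n,R,\epsilon)$ average-case simulation code if $\big\|q(x^n,y^n)-\prod_{i=1}^n p(x_i)p(y_i|x_i)\big\|_1\le\epsilon$, where $\|\cdot\|_1$ is the total variation distance. The pair $(p(x),p(y|x))$ is in the admissible region of $(p(\tilde y|\tilde x),R)$ for the asymptotic average-case model if there is a sequence of $(n,R,\epsilon_n)$ average-case simulation codes with $\lim_{n\to\infty}\epsilon_n=0$. *)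

theory Defs
  imports "HOL-Probability.Probability"
begin

text \<open>Finite alphabets are finite types, pmfs on them are of type \<open>'a pmf\<close>, and a conditional
  pmf $p(b|a)$ is a function \<open>'a \<Rightarrow> 'b pmf\<close>.\<close>

text \<open>A sequence $a^n$ is a function on \<open>nat\<close> whose entries are those at \<open>{..<n}\<close>; the value
  elsewhere is fixed to \<open>undefined\<close>.\<close>

definition seqs :: "nat \<Rightarrow> (nat \<Rightarrow> 'a) set" where
  "seqs n = {..<n} \<rightarrow>\<^sub>E UNIV"

definition iid_pmf :: "nat \<Rightarrow> 'a pmf \<Rightarrow> (nat \<Rightarrow> 'a) pmf" where
  "iid_pmf n p = Pi_pmf {..<n} undefined (\<lambda>_. p)"

definition memoryless :: "nat \<Rightarrow> ('a \<Rightarrow> 'b pmf) \<Rightarrow> (nat \<Rightarrow> 'a) \<Rightarrow> (nat \<Rightarrow> 'b) pmf" where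
  "memoryless n W a = Pi_pmf {..<n} undefined (\<lambda>i. W (a i))"

text \<open>Total variation distance, with the normalisation that makes it range over $[0,1]$.\<close>

definition tv_dist :: "'a pmf \<Rightarrow> 'a pmf \<Rightarrow> real" where
  "tv_dist P Q = (\<Sum>\<^sub>\<infinity>z. \<bar>pmf P z - pmf Q z\<bar>) / 2"

definition joint_pmf :: "'a pmf \<Rightarrow> ('a \<Rightarrow> 'b pmf) \<Rightarrow> ('a \<times> 'b) pmf" where
  "joint_pmf p W = do { a \<leftarrow> p; b \<leftarrow> W a; return_pmf (a, b) }"

text \<open>The range $[1:2^{nR}]$ of the shared randomness, with $2^{nR}$ rounded down.\<close>

definition rand_range :: "nat \<Rightarrow> real \<Rightarrow> nat set" where
  "rand_range n R = {1..nat \<lfloor>2 powr (real n * R)\<rfloor>}"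

text \<open>The law $q(x^n, y^n)$ induced by a code; \<open>enc x \<omega>\<close> is $q^{\rm enc}(\cdot|x^n,\omega)$ and
  \<open>dec yt \<omega>\<close> is $q^{\rm dec}(\cdot|\tilde y^n,\omega)$.\<close>

definition simulated_pmf ::
  "nat \<Rightarrow> real \<Rightarrow> 'x pmf \<Rightarrow> ('xt \<Rightarrow> 'yt pmf)
    \<Rightarrow> ((nat \<Rightarrow> 'x) \<Rightarrow> nat \<Rightarrow> (nat \<Rightarrow> 'xt) pmf) \<Rightarrow> ((nat \<Rightarrow> 'yt) \<Rightarrow> nat \<Rightarrow> (nat \<Rightarrow> 'y) pmf)
    \<Rightarrow> ((nat \<Rightarrow> 'x) \<times> (nat \<Rightarrow> 'y)) pmf" where
  "simulated_pmf n R pX W enc dec = do {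
     x \<leftarrow> iid_pmf n pX;
     \<omega> \<leftarrow> pmf_of_set (rand_range n R);
     xt \<leftarrow> enc x \<omega>;
     yt \<leftarrow> memoryless n W xt;
     y \<leftarrow> dec yt \<omega>;
     return_pmf (x, y)
   }"

definition avg_sim_code ::
  "'x pmf \<Rightarrow> ('x \<Rightarrow> 'y pmf) \<Rightarrow> ('xt \<Rightarrow> 'yt pmf) \<Rightarrow> nat \<Rightarrow> real \<Rightarrow> real
    \<Rightarrow> ((nat \<Rightarrow> 'x) \<Rightarrow> nat \<Rightarrow> (nat \<Rightarrow> 'xt) pmf) \<Rightarrow> ((nat \<Rightarrow> 'yt) \<Rightarrow> nat \<Rightarrow> (nat \<Rightarrow> 'y) pmf)
    \<Rightarrow> bool" where
  "avg_sim_code pX V W n R \<epsilon> enc dec \<longleftrightarrow>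
     (\<forall>x\<in>seqs n. \<forall>\<omega>\<in>rand_range n R. set_pmf (enc x \<omega>) \<subseteq> seqs n) \<and>
     (\<forall>yt\<in>seqs n. \<forall>\<omega>\<in>rand_range n R. set_pmf (dec yt \<omega>) \<subseteq> seqs n) \<and>
     tv_dist (simulated_pmf n R pX W enc dec) (joint_pmf (iid_pmf n pX) (memoryless n V)) \<le> \<epsilon>"

definition avg_admissible ::
  "'x pmf \<Rightarrow> ('x \<Rightarrow> 'y pmf) \<Rightarrow> ('xt \<Rightarrow> 'yt pmf) \<Rightarrow> real \<Rightarrow> bool" where
  "avg_admissible pX V W R \<longleftrightarrow>
     (\<exists>enc dec \<epsilon>. (\<forall>n\<ge>1. avg_sim_code pX V W n R (\<epsilon> n) (enc n) (dec n)) \<and>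
        \<epsilon> \<longlonglongrightarrow> 0)"

text \<open>$p(x)\,p(u,\tilde x|x)\,p(\tilde y|\tilde x)\,p(y|\tilde y,u)$ as a pmf of
  $(u,\tilde x,\tilde y,x,y)$.\<close>

definition aux_pmf ::
  "'x pmf \<Rightarrow> ('x \<Rightarrow> ('u \<times> 'xt) pmf) \<Rightarrow> ('xt \<Rightarrow> 'yt pmf) \<Rightarrow> ('yt \<Rightarrow> 'u \<Rightarrow> 'y pmf)
    \<Rightarrow> ('u \<times> 'xt \<times> 'yt \<times> 'x \<times> 'y) pmf" where
  "aux_pmf pX pUXt W pY = do {
     x \<leftarrow> pX;
     (u, xt) \<leftarrow> pUXt x;
     yt \<leftarrow> W xt;
     y \<leftarrow> pY yt u;
     return_pmf (u, xt, yt, x, y)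
   }"

text \<open>Mutual information in bits of two finite-valued random variables on the space of \<open>P\<close>.\<close>

definition mutual_info :: "'a pmf \<Rightarrow> ('a \<Rightarrow> 'b) \<Rightarrow> ('a \<Rightarrow> 'c) \<Rightarrow> real" where
  "mutual_info P A B =
     prob_space.mutual_information (measure_pmf P) 2 (count_space UNIV) (count_space UNIV) A B"

end

theory Submission
  imports Defs
begin

text \<open>Random coding. Factor the given joint pmf from $U$ outwards, as $p(u)\,p(x|u)\,p(\tilde x|u,x)\,
  p(\tilde y|\tilde x)\,p(y|\tilde y,u)$, choose a rate $R'$ with $I(U;X) < R' < I(U;\tilde Y)$ and
  $R + R' > I(U;XY)$, and draw codewords $u^n(\omega,m)$, $m \le 2^{nR'}$, i.i.d. from $p(u)$. In the
  ideal experiment $m$ is uniform and $(x^n,\tilde x^n,\tilde y^n,y^n)$ is generated from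
  $u^n(\omega,m)$. By soft covering at rate $R + R'$ its law of $(X^n,Y^n)$ is nearly the target.
  By soft covering at rate $R'$, $X^n$ is nearly i.i.d. and independent of $\omega$, so an encoder
  that samples $m$ from its posterior given $(x^n,\omega)$ reproduces the ideal experiment, except
  that the decoder does not know $m$; it recovers $m$ from $\tilde y^n$ by channel coding, since
  $R' < I(U;\tilde Y)$. All three error terms are averaged over the codebook at once.\<close>

section \<open>Total variation distance\<close>

text \<open>The index m is extra common randomness of rate R' carried by the channel itself: R' >
  I(U;X) lets the encoder choose it without distorting the source, and R' < I(U;Yt) lets the decoder
  recover it. The rates differ because \<open>\<omega>\<close> is known at both ends: given
  \<open>\<omega>\<close>, only the words of one block compete in decoding, while the law of the
  pair (X,Y) is averaged over all blocks and so enjoys the rate R + R'. No typical sets occur. Each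
  error is bounded for a single use of arbitrary finite kernels, with a free likelihood-ratio
  threshold \<open>\<gamma>\<close> of its own. The block length enters only when the kernels become
  memoryless: the likelihood ratio is then 2 to a sum of i.i.d. information densities, and a
  threshold 2^(nr), with r strictly between an information and a rate, makes both the tail
  probability and the remaining power of 2 vanish.\<close>

lemma expectation_bind_pmf:
  fixes f :: "'b \<Rightarrow> real"
  assumes "\<And>x. \<bar>f x\<bar> \<le> B"
  shows "measure_pmf.expectation (bind_pmf p F) f
    = measure_pmf.expectation p (\<lambda>a. measure_pmf.expectation (F a) f)"
proof -
  have N: "(\<lambda>x. measure_pmf (F x)) \<in> measurable (measure_pmf p) (subprob_algebra (count_space UNIV))"
    by (simp add: measurable_def space_subprob_algebra prob_space_imp_subprob_space measure_pmf.prob_space_axioms)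
  show ?thesis
    unfolding measure_pmf_bind
    by (rule integral_bind[OF _ assms N, where B'=1])
       (simp_all add: measure_pmf.finite_measure_axioms)
qed

text \<open>Sequences are functions on all of \<open>nat\<close>, so their type may be infinite even
  when the law has finite support, and \<open>tv_dist\<close> is an \<open>infsum\<close>. This is
  the bridge from such sums to expectations; boundedness supplies summability.\<close>

lemma has_sum_pmf_expectation:
  fixes f :: "'a \<Rightarrow> real"
  assumes "\<And>x. \<bar>f x\<bar> \<le> B"
  shows "((\<lambda>x. pmf p x * f x) has_sum measure_pmf.expectation p f) UNIV"
proof -
  have "integrable (measure_pmf p) f"
    by (rule measure_pmf.integrable_const_bound[where B=B]) (use assms in auto)
  then have "Infinite_Set_Sum.abs_summable_on (\<lambda>x. pmf p x * f x) UNIV"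
    by (simp add: Infinite_Set_Sum.abs_summable_on_def measure_pmf_eq_density integrable_density)
  then have "infsetsum (\<lambda>x. pmf p x * f x) UNIV = infsum (\<lambda>x. pmf p x * f x) UNIV"
      "(\<lambda>x. pmf p x * f x) summable_on UNIV"
    using infsetsum_infsum abs_summable_equivalent abs_summable_summable by blast+
  then show ?thesis
    unfolding pmf_expectation_eq_infsetsum by simp
qed

lemma has_sum_diff_real:
  fixes f g :: "'a \<Rightarrow> real"
  assumes "(f has_sum a) A" "(g has_sum b) A"
  shows "((\<lambda>x. f x - g x) has_sum (a - b)) A"
  using has_sum_add[OF assms(1), of "\<lambda>x. - g x" "- b"] assms(2) by (simp add: has_sum_uminus)

text \<open>Both pmfs sum to 1, so adding the signed difference leaves the sum unchanged and turns
  each term into the positive part of \<open>pmf P x - pmf Q x\<close>, which can be compared term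
  by term with a test function.\<close>

lemma tv_dist_has_sum:
  "((\<lambda>x. (\<bar>pmf P x - pmf Q x\<bar> + (pmf P x - pmf Q x)) / 2) has_sum tv_dist P Q) UNIV"
proof -
  have s: "((\<lambda>x. pmf p x) has_sum 1) UNIV" for p :: "'a pmf"
    using has_sum_pmf_expectation[of "\<lambda>_. 1" 1 p] by simp
  have d: "((\<lambda>x. pmf P x - pmf Q x) has_sum 0) UNIV"
    using has_sum_diff_real[OF s s] by simp
  have "(\<lambda>x. \<bar>pmf P x - pmf Q x\<bar>) summable_on UNIV"
    using has_sum_imp_summable[OF d] by (subst (asm) summable_on_iff_abs_summable_on_real) simp
  then have "((\<lambda>x. \<bar>pmf P x - pmf Q x\<bar>) has_sum (\<Sum>\<^sub>\<infinity>x. \<bar>pmf P x - pmf Q x\<bar>)) UNIV"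
    by (rule has_sum_infsum)
  from has_sum_cmult_right[OF has_sum_add[OF this d], of "1/2"] show ?thesis
    by (simp add: tv_dist_def)
qed

text \<open>One half of the variational formula: the distance is the largest gap between
  expectations of [0,1]-valued functions. The triangle inequality and the rules for
  \<open>bind_pmf\<close> follow from it and the converse bound
  \<open>expectation_diff_le_tv_dist\<close>.\<close>

lemma tv_dist_le:
  assumes "\<And>f :: 'a \<Rightarrow> real. (\<And>x. 0 \<le> f x \<and> f x \<le> 1) \<Longrightarrow>
    measure_pmf.expectation P f - measure_pmf.expectation Q f \<le> e"
  shows "tv_dist P Q \<le> e"
proof -
  \<comment> \<open>The optimal test: it keeps exactly the points where the signed difference is
    non-negative.\<close>
  define f :: "'a \<Rightarrow> real" where "f x = (if pmf P x \<ge> pmf Q x then 1 else 0)" for x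
  have b: "\<bar>f x\<bar> \<le> 1" for x by (simp add: f_def)
  have "((\<lambda>x. pmf P x * f x - pmf Q x * f x) has_sum
      (measure_pmf.expectation P f - measure_pmf.expectation Q f)) UNIV"
    by (intro has_sum_diff_real has_sum_pmf_expectation[where f=f, OF b])
  also have "(\<lambda>x. pmf P x * f x - pmf Q x * f x) =
      (\<lambda>x. (\<bar>pmf P x - pmf Q x\<bar> + (pmf P x - pmf Q x)) / 2)"
    by (auto simp: f_def fun_eq_iff)
  finally have "tv_dist P Q = measure_pmf.expectation P f - measure_pmf.expectation Q f"
    using tv_dist_has_sum has_sum_unique by blast
  also have "\<dots> \<le> e"
    by (rule assms) (simp add: f_def)
  finally show ?thesis .
qed

lemma expectation_diff_le_tv_dist:
  fixes f :: "'a \<Rightarrow> real"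
  assumes "\<And>x. 0 \<le> f x \<and> f x \<le> 1"
  shows "measure_pmf.expectation P f - measure_pmf.expectation Q f \<le> tv_dist P Q"
proof (rule has_sum_mono[OF _ tv_dist_has_sum])
  have b: "\<bar>f x\<bar> \<le> 1" for x using assms[of x] by simp
  show "((\<lambda>x. pmf P x * f x - pmf Q x * f x) has_sum
      (measure_pmf.expectation P f - measure_pmf.expectation Q f)) UNIV"
    by (intro has_sum_diff_real has_sum_pmf_expectation[where f=f, OF b])
  fix x
  show "pmf P x * f x - pmf Q x * f x \<le> (\<bar>pmf P x - pmf Q x\<bar> + (pmf P x - pmf Q x)) / 2"
  proof (cases "pmf P x \<ge> pmf Q x")
    case True
    then have "(pmf P x - pmf Q x) * f x \<le> (pmf P x - pmf Q x) * 1"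
      using assms by (intro mult_left_mono) auto
    with True show ?thesis by (simp add: algebra_simps)
  next
    case False
    then have "(pmf P x - pmf Q x) * f x \<le> 0"
      using assms by (intro mult_nonpos_nonneg) auto
    with False show ?thesis by (simp add: algebra_simps)
  qed
qed

lemma tv_dist_finite:
  assumes "finite S" "set_pmf P \<subseteq> S" "set_pmf Q \<subseteq> S"
  shows "tv_dist P Q = (\<Sum>z\<in>S. \<bar>pmf P z - pmf Q z\<bar>) / 2"
proof -
  have "(\<Sum>\<^sub>\<infinity>z. \<bar>pmf P z - pmf Q z\<bar>) = (\<Sum>\<^sub>\<infinity>z\<in>S. \<bar>pmf P z - pmf Q z\<bar>)"
  proof (rule infsum_cong_neutral)
    fix z assume "z \<in> UNIV - S"
    then have "pmf P z = 0" "pmf Q z = 0"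
      using assms by (auto simp: pmf_eq_0_set_pmf)
    then show "\<bar>pmf P z - pmf Q z\<bar> = 0" by simp
  qed auto
  then show ?thesis
    using assms by (simp add: tv_dist_def)
qed

lemma tv_dist_nonneg: "tv_dist P Q \<ge> 0"
  by (rule has_sum_nonneg[OF tv_dist_has_sum]) auto

lemma tv_dist_self: "tv_dist P P = 0"
  by (simp add: tv_dist_def)

lemma tv_dist_triangle:
  fixes P Q T :: "'a pmf"
  shows "tv_dist P Q \<le> tv_dist P T + tv_dist T Q"
proof (rule tv_dist_le)
  fix f :: "'a \<Rightarrow> real" assume f: "\<And>x. 0 \<le> f x \<and> f x \<le> 1"
  show "measure_pmf.expectation P f - measure_pmf.expectation Q f \<le> tv_dist P T + tv_dist T Q"
    using expectation_diff_le_tv_dist[where f=f and P=P and Q=T, OF f] expectation_diff_le_tv_dist[where f=f and P=T and Q=Q, OF f] by simp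
qed

lemma expectation_in_unit_interval:
  fixes f :: "'a \<Rightarrow> real"
  assumes "\<And>x. 0 \<le> f x \<and> f x \<le> 1"
  shows "0 \<le> measure_pmf.expectation p f \<and> measure_pmf.expectation p f \<le> 1"
proof -
  have "integrable (measure_pmf p) f"
    by (rule measure_pmf.integrable_const_bound[where B=1]) (use assms in auto)
  then have "measure_pmf.expectation p f \<le> 1"
    using assms by (intro measure_pmf.integral_le_const) auto
  moreover have "0 \<le> measure_pmf.expectation p f"
    by (rule Bochner_Integration.integral_nonneg) (use assms in blast)
  ultimately show ?thesis by blast
qed

lemma tv_dist_commute: "tv_dist P Q = tv_dist Q P"
  by (simp add: tv_dist_def abs_minus_commute)

text \<open>Data processing: averaging a test function over the kernel \<open>F\<close> gives a
  [0,1]-valued function of the input, which is again a test function.\<close>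

lemma tv_dist_bind_left:
  fixes F :: "'a \<Rightarrow> 'b pmf"
  shows "tv_dist (bind_pmf P F) (bind_pmf Q F) \<le> tv_dist P Q"
proof (rule tv_dist_le)
  fix f :: "'b \<Rightarrow> real" assume f: "\<And>x. 0 \<le> f x \<and> f x \<le> 1"
  have b: "\<bar>f x\<bar> \<le> 1" for x using f[of x] by simp
  show "measure_pmf.expectation (bind_pmf P F) f - measure_pmf.expectation (bind_pmf Q F) f \<le> tv_dist P Q"
    unfolding expectation_bind_pmf[where f=f, OF b]
    by (rule expectation_diff_le_tv_dist) (rule expectation_in_unit_interval[where f=f, OF f])
qed

lemma tv_dist_map: "tv_dist (map_pmf h P) (map_pmf h Q) \<le> tv_dist P Q"
  unfolding map_pmf_def by (rule tv_dist_bind_left)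

lemma tv_dist_le_1:
  fixes P Q :: "'a pmf"
  shows "tv_dist P Q \<le> 1"
proof (rule tv_dist_le)
  fix f :: "'a \<Rightarrow> real" assume f: "\<And>x. 0 \<le> f x \<and> f x \<le> 1"
  show "measure_pmf.expectation P f - measure_pmf.expectation Q f \<le> 1"
    using expectation_in_unit_interval[where f=f and p=P, OF f] expectation_in_unit_interval[where f=f and p=Q, OF f] by linarith
qed

lemma tv_dist_bind_right:
  fixes F G :: "'a \<Rightarrow> 'b pmf"
  shows "tv_dist (bind_pmf P F) (bind_pmf P G) \<le> measure_pmf.expectation P (\<lambda>a. tv_dist (F a) (G a))"
proof (rule tv_dist_le)
  fix f :: "'b \<Rightarrow> real" assume f: "\<And>x. 0 \<le> f x \<and> f x \<le> 1"
  have b: "\<bar>f x\<bar> \<le> 1" for x using f[of x] by simp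
  have i: "integrable (measure_pmf P) (\<lambda>a. measure_pmf.expectation (H a) f)" for H :: "'a \<Rightarrow> 'b pmf"
  proof (intro measure_pmf.integrable_const_bound[where B=1] AE_I2)
    fix a show "norm (measure_pmf.expectation (H a) f) \<le> 1"
      unfolding real_norm_def using expectation_in_unit_interval[where f=f and p="H a", OF f] by linarith
  qed simp
  have i2: "integrable (measure_pmf P) (\<lambda>a. tv_dist (F a) (G a))"
    by (intro measure_pmf.integrable_const_bound[where B=1])
       (simp_all add: tv_dist_nonneg tv_dist_le_1)
  show "measure_pmf.expectation (bind_pmf P F) f - measure_pmf.expectation (bind_pmf P G) f
      \<le> measure_pmf.expectation P (\<lambda>a. tv_dist (F a) (G a))"
    unfolding expectation_bind_pmf[where f=f, OF b] Bochner_Integration.integral_diff[OF i i, symmetric]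
    by (intro integral_mono Bochner_Integration.integrable_diff i i2 expectation_diff_le_tv_dist[where f=f, OF f])
qed

section \<open>Independent codewords\<close>

lemma finite_set_Pi_pmf:
  assumes "finite I" "\<And>i. i \<in> I \<Longrightarrow> finite (set_pmf (p i))"
  shows "finite (set_pmf (Pi_pmf I d p))"
  using assms by (auto simp: set_Pi_pmf intro!: finite_PiE_dflt)

lemma expectation_iid_component:
  fixes g :: "'a \<Rightarrow> real"
  assumes "finite I" "k \<in> I"
  shows "measure_pmf.expectation (Pi_pmf I d (\<lambda>_. p)) (\<lambda>c. g (c k)) = measure_pmf.expectation p g"
proof -
  have "measure_pmf.expectation (map_pmf (\<lambda>c. c k) (Pi_pmf I d (\<lambda>_. p))) g = measure_pmf.expectation p g"
    using assms by (simp add: Pi_pmf_component del: integral_map_pmf)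
  then show ?thesis by simp
qed

lemma map_iid_pair:
  assumes "finite I" "k \<in> I" "l \<in> I" "k \<noteq> l"
  shows "map_pmf (\<lambda>c. (c k, c l)) (Pi_pmf I d (\<lambda>_. p)) = pair_pmf p p"
proof -
  define J where "J = I - {k}"
  have I: "I = insert k J" "k \<notin> J" "finite J" "l \<in> J"
    using assms by (auto simp: J_def)
  have "map_pmf (\<lambda>c. (c k, c l)) (Pi_pmf I d (\<lambda>_. p))
      = map_pmf (\<lambda>(y, f). (y, f l)) (pair_pmf p (Pi_pmf J d (\<lambda>_. p)))"
    unfolding I(1) using I assms(4)
    by (simp add: Pi_pmf_insert map_pmf_comp case_prod_beta')
  also have "\<dots> = pair_pmf (map_pmf id p) (map_pmf (\<lambda>f. f l) (Pi_pmf J d (\<lambda>_. p)))"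
    using map_pair[of id "\<lambda>f. f l"] by simp
  also have "\<dots> = pair_pmf p p"
    using I by (simp add: Pi_pmf_component pmf.map_id)
  finally show ?thesis .
qed

lemma expectation_pair_pmf_finite:
  fixes h :: "'a \<Rightarrow> 'b \<Rightarrow> real"
  assumes "finite (set_pmf p)" "finite (set_pmf q)"
  shows "measure_pmf.expectation (pair_pmf p q) (\<lambda>(a, b). h a b)
    = measure_pmf.expectation p (\<lambda>a. measure_pmf.expectation q (h a))"
proof -
  have "measure_pmf.expectation (pair_pmf p q) (\<lambda>(a, b). h a b)
      = (\<Sum>z\<in>set_pmf p \<times> set_pmf q. (case z of (a, b) \<Rightarrow> h a b) * pmf (pair_pmf p q) z)"
    using assms by (intro integral_measure_pmf_real) auto
  also have "\<dots> = (\<Sum>a\<in>set_pmf p. \<Sum>b\<in>set_pmf q. h a b * (pmf p a * pmf q b))"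
    by (auto simp: sum.cartesian_product pmf_pair intro!: sum.cong)
  also have "\<dots> = (\<Sum>a\<in>set_pmf p. (\<Sum>b\<in>set_pmf q. h a b * pmf q b) * pmf p a)"
    by (simp add: sum_distrib_right sum_distrib_left mult_ac)
  also have "\<dots> = measure_pmf.expectation p (\<lambda>a. measure_pmf.expectation q (h a))"
    using assms by (simp add: integral_measure_pmf_real[of "set_pmf q"] integral_measure_pmf_real[of "set_pmf p"])
  finally show ?thesis .
qed

lemma expectation_iid_pair:
  fixes h :: "'a \<Rightarrow> 'a \<Rightarrow> real"
  assumes "finite I" "k \<in> I" "l \<in> I" "k \<noteq> l" "finite (set_pmf p)"
  shows "measure_pmf.expectation (Pi_pmf I d (\<lambda>_. p)) (\<lambda>c. h (c k) (c l))
    = measure_pmf.expectation p (\<lambda>a. measure_pmf.expectation p (h a))"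
proof -
  have "measure_pmf.expectation (Pi_pmf I d (\<lambda>_. p)) (\<lambda>c. h (c k) (c l))
      = measure_pmf.expectation (map_pmf (\<lambda>c. (c k, c l)) (Pi_pmf I d (\<lambda>_. p))) (\<lambda>(a, b). h a b)"
    by simp
  then show ?thesis
    by (simp only: map_iid_pair[OF assms(1-4)] expectation_pair_pmf_finite[OF assms(5,5)])
qed

text \<open>Distinct entries are independent, so after centring the cross terms vanish and only
  \<open>card I\<close> diagonal ones remain; the variance is then bounded by the raw second moment.
  The average runs over a part \<open>I\<close> of the index set \<open>I'\<close> because one
  codebook has to serve each of its blocks.\<close>

lemma second_moment_iid_average:
  fixes g :: "'a \<Rightarrow> real"
  assumes fp: "finite (set_pmf p)" and I': "finite I'" and I: "I \<subseteq> I'" "I \<noteq> {}"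
  shows "measure_pmf.expectation (Pi_pmf I' d (\<lambda>_. p))
      (\<lambda>c. ((\<Sum>k\<in>I. g (c k)) / card I - measure_pmf.expectation p g)\<^sup>2)
    \<le> measure_pmf.expectation p (\<lambda>u. (g u)\<^sup>2) / card I"
proof -
  let ?E = "measure_pmf.expectation (Pi_pmf I' d (\<lambda>_. p))"
  define m where "m = measure_pmf.expectation p g"
  define h where "h u = g u - m" for u
  have fI: "finite I" and N: "real (card I) > 0"
    using I I' by (auto intro: finite_subset simp: card_gt_0_iff)
  have int: "integrable (measure_pmf p) f" for f :: "'a \<Rightarrow> real"
    using fp by (rule integrable_measure_pmf_finite)
  have intI: "integrable (measure_pmf (Pi_pmf I' d (\<lambda>_. p))) f" for f :: "_ \<Rightarrow> real"
    using fp I' by (intro integrable_measure_pmf_finite finite_set_Pi_pmf)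
  have Eh: "measure_pmf.expectation p h = 0"
    using int by (simp add: h_def[abs_def] m_def)
  have "measure_pmf.expectation p (\<lambda>u. (h u)\<^sup>2)
      = measure_pmf.expectation p (\<lambda>u. (g u)\<^sup>2 + (m\<^sup>2 - 2 * m * g u))"
    by (simp add: h_def power2_diff algebra_simps)
  also have "\<dots> = measure_pmf.expectation p (\<lambda>u. (g u)\<^sup>2) + (m\<^sup>2 - 2 * m * m)"
    using int by (simp add: m_def)
  finally have h2: "measure_pmf.expectation p (\<lambda>u. (h u)\<^sup>2) \<le> measure_pmf.expectation p (\<lambda>u. (g u)\<^sup>2)"
    by (simp add: power2_eq_square)
  have kl: "?E (\<lambda>c. h (c k) * h (c l)) = (if k = l then measure_pmf.expectation p (\<lambda>u. (h u)\<^sup>2) else 0)"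
    if "k \<in> I" "l \<in> I" for k l
  proof (cases "k = l")
    case True
    then show ?thesis
      using expectation_iid_component[of I' k d p "\<lambda>u. (h u)\<^sup>2"] that I I'
      by (auto simp: power2_eq_square)
  next
    case False
    then have "?E (\<lambda>c. h (c k) * h (c l))
        = measure_pmf.expectation p (\<lambda>a. measure_pmf.expectation p (\<lambda>b. h a * h b))"
      using that I I' fp by (intro expectation_iid_pair) auto
    with False Eh show ?thesis by simp
  qed
  have eq: "((\<Sum>k\<in>I. g (c k)) / card I - m)\<^sup>2 = (\<Sum>k\<in>I. \<Sum>l\<in>I. h (c k) * h (c l)) / (card I)\<^sup>2" for c
  proof -
    have "(\<Sum>k\<in>I. g (c k)) / card I - m = (\<Sum>k\<in>I. h (c k)) / card I"
      using N by (simp add: h_def sum_subtractf field_simps)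
    then show ?thesis
      by (simp add: power_divide power2_eq_square sum_product)
  qed
  have "?E (\<lambda>c. ((\<Sum>k\<in>I. g (c k)) / card I - m)\<^sup>2)
      = (\<Sum>k\<in>I. \<Sum>l\<in>I. ?E (\<lambda>c. h (c k) * h (c l))) / (card I)\<^sup>2"
    unfolding eq using intI by (simp add: Bochner_Integration.integral_sum)
  also have "\<dots> = (\<Sum>k\<in>I. \<Sum>l\<in>I. if k = l then measure_pmf.expectation p (\<lambda>u. (h u)\<^sup>2) else 0) / (card I)\<^sup>2"
    using kl by simp
  also have "\<dots> = measure_pmf.expectation p (\<lambda>u. (h u)\<^sup>2) / card I"
    using fI N by (simp add: power2_eq_square)
  also have "\<dots> \<le> measure_pmf.expectation p (\<lambda>u. (g u)\<^sup>2) / card I"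
    using h2 N by (simp add: divide_right_mono)
  finally show ?thesis by (simp add: m_def)
qed

lemma prob_joint_pmf:
  "measure_pmf.prob (joint_pmf p K) {(u, z). P u z}
    = measure_pmf.expectation p (\<lambda>u. measure_pmf.prob (K u) {z. P u z})"
proof -
  have ind: "measure_pmf.prob q A = measure_pmf.expectation q (indicator A)" for q :: "'b pmf" and A
    by simp
  have "measure_pmf.prob (joint_pmf p K) {(u, z). P u z}
      = measure_pmf.expectation (joint_pmf p K) (indicator {(u, z). P u z})"
    by simp
  also have "\<dots> = measure_pmf.expectation p (\<lambda>u. measure_pmf.expectation (K u)
      (\<lambda>z. measure_pmf.expectation (return_pmf (u, z)) (indicator {(u, z). P u z})))"
    unfolding joint_pmf_def
    by (subst expectation_bind_pmf[where B=1], simp add: indicator_def)+ simp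
  also have "\<dots> = measure_pmf.expectation p (\<lambda>u. measure_pmf.expectation (K u) (indicator {z. P u z}))"
    by (intro Bochner_Integration.integral_cong refl) (simp add: indicator_def)
  finally show ?thesis unfolding ind .
qed

section \<open>Soft covering and channel coding with random codebooks\<close>

text \<open>A plain variance bound fails because the second moment of \<open>pmf (K u) z\<close> can
  be large. The kernel is therefore cut at likelihood ratio \<open>\<gamma>\<close>: the lower part
  has a relative deviation of at most \<open>sqrt (\<gamma> / card I)\<close>, and the upper part is
  controlled in mean only, through its total mass.\<close>

lemma soft_covering:
  fixes K :: "'u \<Rightarrow> 'z pmf"
  assumes fp: "finite (set_pmf p)" and fK: "\<And>u. finite (set_pmf (K u))"
    and I': "finite I'" and I: "I \<subseteq> I'" "I \<noteq> {}" and \<gamma>: "\<gamma> > 0"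
  shows "measure_pmf.expectation (Pi_pmf I' d (\<lambda>_. p))
      (\<lambda>c. tv_dist (bind_pmf (pmf_of_set I) (\<lambda>k. K (c k))) (bind_pmf p K))
    \<le> measure_pmf.prob (joint_pmf p K) {(u, z). pmf (K u) z > \<gamma> * pmf (bind_pmf p K) z}
      + sqrt (\<gamma> / card I) / 2"
proof -
  let ?C = "Pi_pmf I' d (\<lambda>_. p)"
  let ?E = "measure_pmf.expectation ?C"
  define Q where "Q = bind_pmf p K"
  define S where "S = set_pmf Q"
  define N where "N = real (card I)"
  define bad where "bad u z = (if pmf (K u) z > \<gamma> * pmf Q z then pmf (K u) z else 0)" for u z
  define good where "good u z = (if pmf (K u) z > \<gamma> * pmf Q z then 0 else pmf (K u) z)" for u z
  have fI: "finite I" and N: "N > 0"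
    using I I' by (auto intro: finite_subset simp: card_gt_0_iff N_def)
  have SU: "S = (\<Union>u\<in>set_pmf p. set_pmf (K u))"
    by (simp add: S_def Q_def)
  then have fS: "finite S"
    using fp fK by simp
  have int: "integrable (measure_pmf p) f" for f :: "'u \<Rightarrow> real"
    using fp by (rule integrable_measure_pmf_finite)
  have intC: "integrable (measure_pmf ?C) f" for f :: "_ \<Rightarrow> real"
    using fp I' by (intro integrable_measure_pmf_finite finite_set_Pi_pmf)
  have Qz: "pmf Q z = measure_pmf.expectation p (\<lambda>u. pmf (K u) z)" for z
    by (simp add: Q_def pmf_bind)
  have split: "pmf (K u) z = good u z + bad u z" for u z
    by (simp add: good_def bad_def)
  define b where "b z = measure_pmf.expectation p (\<lambda>u. bad u z)" for z
  define g where "g z = measure_pmf.expectation p (\<lambda>u. good u z)" for z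
  have b0: "b z \<ge> 0" for z
    unfolding b_def by (intro Bochner_Integration.integral_nonneg) (simp add: bad_def)
  have Qgb: "pmf Q z = g z + b z" for z
    unfolding Qz g_def b_def split using int by simp
  have dev: "?E (\<lambda>c. \<bar>(\<Sum>k\<in>I. good (c k) z) / N - g z\<bar>) \<le> sqrt (\<gamma> / N) * pmf Q z" if "z \<in> S" for z
  proof -
    \<comment> \<open>\<open>t\<close> bounds the root mean square deviation; with this value both
      summands of the inequality below are at most \<open>t / 2\<close> on average. It is positive
      because \<open>z\<close> lies in the support of \<open>Q\<close>.\<close>
    define t where "t = sqrt (\<gamma> / N) * pmf Q z"
    have Qpos: "pmf Q z > 0"
      using that by (simp add: S_def pmf_positive)
    have t: "t > 0"
      using Qpos \<gamma> N by (simp add: t_def)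
    have "measure_pmf.expectation p (\<lambda>u. (good u z)\<^sup>2)
        \<le> measure_pmf.expectation p (\<lambda>u. \<gamma> * pmf Q z * pmf (K u) z)"
      using int by (intro integral_mono)
        (auto simp: good_def power2_eq_square not_less \<gamma> less_imp_le intro!: mult_right_mono)
    also have "\<dots> = \<gamma> * (pmf Q z)\<^sup>2"
      by (simp add: Qz power2_eq_square)
    finally have "measure_pmf.expectation p (\<lambda>u. (good u z)\<^sup>2) / N \<le> \<gamma> * (pmf Q z)\<^sup>2 / N"
      using N by (simp add: divide_right_mono)
    also have "\<dots> = t\<^sup>2"
      using \<gamma> N by (simp add: t_def power_mult_distrib)
    finally have *: "?E (\<lambda>c. ((\<Sum>k\<in>I. good (c k) z) / N - g z)\<^sup>2) \<le> t\<^sup>2"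
      using second_moment_iid_average[OF fp I' I, of d "\<lambda>u. good u z"] by (simp add: N_def g_def)
    \<comment> \<open>\<open>\<bar>a\<bar> \<le> (a\<^sup>2 / t + t) / 2\<close> replaces Jensen's inequality\<close>
    have amgm: "\<bar>a\<bar> \<le> a\<^sup>2 / (2 * t) + t / 2" for a
    proof -
      have "0 \<le> (\<bar>a\<bar> - t)\<^sup>2" by simp
      then have "2 * t * \<bar>a\<bar> \<le> a\<^sup>2 + t\<^sup>2"
        by (simp add: power2_diff algebra_simps)
      with t show ?thesis
        by (simp add: field_simps power2_eq_square)
    qed
    have "?E (\<lambda>c. \<bar>(\<Sum>k\<in>I. good (c k) z) / N - g z\<bar>)
        \<le> ?E (\<lambda>c. ((\<Sum>k\<in>I. good (c k) z) / N - g z)\<^sup>2 / (2 * t) + t / 2)"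
      by (intro integral_mono intC amgm)
    also have "\<dots> = ?E (\<lambda>c. ((\<Sum>k\<in>I. good (c k) z) / N - g z)\<^sup>2) / (2 * t) + t / 2"
      using intC by simp
    also have "\<dots> \<le> t\<^sup>2 / (2 * t) + t / 2"
      using * t by (simp add: divide_right_mono)
    also have "\<dots> = t"
      using t by (simp add: power2_eq_square)
    finally show ?thesis by (simp add: t_def)
  qed
  have badavg: "?E (\<lambda>c. (\<Sum>k\<in>I. bad (c k) z) / N) = b z" for z
  proof -
    have "?E (\<lambda>c. (\<Sum>k\<in>I. bad (c k) z) / N) = (\<Sum>k\<in>I. ?E (\<lambda>c. bad (c k) z)) / N"
      using intC by (simp add: Bochner_Integration.integral_sum)
    also have "\<dots> = (\<Sum>k\<in>I. b z) / N"
      using I I' expectation_iid_component[of I' _ d p "\<lambda>u. bad u z"]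
      by (intro arg_cong[where f="\<lambda>x. x / N"] sum.cong refl) (auto simp: b_def)
    finally show ?thesis using N by (simp add: N_def)
  qed
  have sumb: "(\<Sum>z\<in>S. b z) = measure_pmf.prob (joint_pmf p K) {(u, z). pmf (K u) z > \<gamma> * pmf Q z}"
  proof -
    have "(\<Sum>z\<in>S. b z) = measure_pmf.expectation p (\<lambda>u. \<Sum>z\<in>S. bad u z)"
      unfolding b_def using int by (simp add: Bochner_Integration.integral_sum)
    also have "\<dots> = measure_pmf.expectation p (\<lambda>u. measure_pmf.prob (K u) {z. pmf (K u) z > \<gamma> * pmf Q z})"
    proof (intro integral_cong_AE AE_pmfI)
      fix u assume u: "u \<in> set_pmf p"
      have "measure_pmf.prob (K u) {z. pmf (K u) z > \<gamma> * pmf Q z}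
          = measure_pmf.prob (K u) (S \<inter> {z. pmf (K u) z > \<gamma> * pmf Q z})"
        using u by (intro measure_prob_cong_0) (auto simp: SU pmf_eq_0_set_pmf)
      also have "\<dots> = (\<Sum>z\<in>S \<inter> {z. pmf (K u) z > \<gamma> * pmf Q z}. pmf (K u) z)"
        using fS by (simp add: measure_measure_pmf_finite)
      also have "\<dots> = (\<Sum>z\<in>S. bad u z)"
        using fS by (simp add: bad_def sum.inter_restrict)
      finally show "(\<Sum>z\<in>S. bad u z) = measure_pmf.prob (K u) {z. pmf (K u) z > \<gamma> * pmf Q z}" ..
    qed auto
    finally show ?thesis by (simp add: prob_joint_pmf)
  qed
  \<comment> \<open>Only codebooks of positive probability are considered: their words lie in the
    support of \<open>p\<close>, so \<open>S\<close> also carries the empirical mixture. The cut-off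
    mass appears twice, as an empirical average and as its mean \<open>b z\<close>; the factor 1/2
    in the distance makes up for that.\<close>
  have pt: "tv_dist (bind_pmf (pmf_of_set I) (\<lambda>k. K (c k))) Q
      \<le> (\<Sum>z\<in>S. \<bar>(\<Sum>k\<in>I. good (c k) z) / N - g z\<bar> + (\<Sum>k\<in>I. bad (c k) z) / N + b z) / 2"
    if c: "c \<in> set_pmf ?C" for c
  proof -
    have "c k \<in> set_pmf p" if "k \<in> I" for k
      using c that I I' by (auto simp: set_Pi_pmf PiE_dflt_def)
    then have "set_pmf (bind_pmf (pmf_of_set I) (\<lambda>k. K (c k))) \<subseteq> S"
      using fI I by (auto simp: SU)
    then have "tv_dist (bind_pmf (pmf_of_set I) (\<lambda>k. K (c k))) Q
        = (\<Sum>z\<in>S. \<bar>(\<Sum>k\<in>I. pmf (K (c k)) z) / N - pmf Q z\<bar>) / 2"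
      using fS I fI by (subst tv_dist_finite[of S]) (auto simp: S_def pmf_bind_pmf_of_set N_def)
    also have "\<dots> \<le> (\<Sum>z\<in>S. \<bar>(\<Sum>k\<in>I. good (c k) z) / N - g z\<bar> + (\<Sum>k\<in>I. bad (c k) z) / N + b z) / 2"
    proof (intro divide_right_mono sum_mono)
      fix z
      have "(\<Sum>k\<in>I. bad (c k) z) / N \<ge> 0"
        using N by (auto simp: bad_def intro!: sum_nonneg divide_nonneg_pos)
      moreover have "(\<Sum>k\<in>I. pmf (K (c k)) z) / N = (\<Sum>k\<in>I. good (c k) z) / N + (\<Sum>k\<in>I. bad (c k) z) / N"
        by (simp add: split sum.distrib add_divide_distrib)
      ultimately show "\<bar>(\<Sum>k\<in>I. pmf (K (c k)) z) / N - pmf Q z\<bar>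
          \<le> \<bar>(\<Sum>k\<in>I. good (c k) z) / N - g z\<bar> + (\<Sum>k\<in>I. bad (c k) z) / N + b z"
        using b0[of z] unfolding Qgb by linarith
    qed simp
    finally show ?thesis .
  qed
  have "?E (\<lambda>c. tv_dist (bind_pmf (pmf_of_set I) (\<lambda>k. K (c k))) Q)
      \<le> ?E (\<lambda>c. (\<Sum>z\<in>S. \<bar>(\<Sum>k\<in>I. good (c k) z) / N - g z\<bar> + (\<Sum>k\<in>I. bad (c k) z) / N + b z) / 2)"
    by (intro integral_mono_AE intC AE_pmfI pt)
  also have "\<dots> = (\<Sum>z\<in>S. ?E (\<lambda>c. \<bar>(\<Sum>k\<in>I. good (c k) z) / N - g z\<bar>) + b z + b z) / 2"
    using intC badavg by (simp add: Bochner_Integration.integral_sum)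
  also have "\<dots> \<le> (\<Sum>z\<in>S. sqrt (\<gamma> / N) * pmf Q z + b z + b z) / 2"
    using dev by (intro divide_right_mono sum_mono add_mono) auto
  also have "\<dots> = sqrt (\<gamma> / N) * (\<Sum>z\<in>S. pmf Q z) / 2 + (\<Sum>z\<in>S. b z)"
    by (simp add: sum.distrib add_divide_distrib flip: sum_distrib_left)
  also have "(\<Sum>z\<in>S. pmf Q z) = 1"
    using fS by (simp add: S_def sum_pmf_eq_1)
  finally show ?thesis
    by (simp add: sumb Q_def N_def)
qed

text \<open>The decoder returns some index whose word passes the likelihood-ratio test. It errs only
  if the sent word fails the test or a different word passes. If no word passes, \<open>SOME\<close>
  yields an arbitrary index, but then the sent word has failed.\<close>

lemma threshold_decoding:
  fixes K :: "'u \<Rightarrow> 'z pmf"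
  assumes fp: "finite (set_pmf p)" and fK: "\<And>u. finite (set_pmf (K u))"
    and I': "finite I'" and I: "I \<subseteq> I'" "I \<noteq> {}" and \<gamma>: "\<gamma> > 0"
  shows "measure_pmf.expectation (Pi_pmf I' d (\<lambda>_. p))
      (\<lambda>c. (\<Sum>k\<in>I. measure_pmf.prob (K (c k))
        {z. (SOME l. l \<in> I \<and> pmf (K (c l)) z > \<gamma> * pmf (bind_pmf p K) z) \<noteq> k}) / card I)
    \<le> measure_pmf.prob (joint_pmf p K) {(u, z). pmf (K u) z \<le> \<gamma> * pmf (bind_pmf p K) z}
      + card I / \<gamma>"
proof -
  let ?C = "Pi_pmf I' d (\<lambda>_. p)"
  let ?E = "measure_pmf.expectation ?C"
  define Q where "Q = bind_pmf p K"
  define err where "err c k = measure_pmf.prob (K (c k))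
    {z. (SOME l. l \<in> I \<and> pmf (K (c l)) z > \<gamma> * pmf Q z) \<noteq> k}" for c k
  define miss where "miss u = measure_pmf.prob (K u) {z. pmf (K u) z \<le> \<gamma> * pmf Q z}" for u
  define conf where "conf v u = measure_pmf.prob (K u) {z. pmf (K v) z > \<gamma> * pmf Q z}" for v u
  have fI: "finite I" and N: "real (card I) > 0"
    using I I' by (auto intro: finite_subset simp: card_gt_0_iff)
  have intC: "integrable (measure_pmf ?C) f" for f :: "_ \<Rightarrow> real"
    using fp I' by (intro integrable_measure_pmf_finite finite_set_Pi_pmf)
  have int: "integrable (measure_pmf p) f" for f :: "'u \<Rightarrow> real"
    using fp by (rule integrable_measure_pmf_finite)
  have fQ: "finite (set_pmf Q)"
    using fp fK by (simp add: Q_def)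
  have ub: "err c k \<le> miss (c k) + (\<Sum>l\<in>I - {k}. conf (c l) (c k))" if k: "k \<in> I" for c k
  proof -
    let ?A = "{z. pmf (K (c k)) z \<le> \<gamma> * pmf Q z}"
    let ?B = "\<lambda>l. {z. pmf (K (c l)) z > \<gamma> * pmf Q z}"
    have "{z. (SOME l. l \<in> I \<and> pmf (K (c l)) z > \<gamma> * pmf Q z) \<noteq> k} \<subseteq> ?A \<union> (\<Union>l\<in>I - {k}. ?B l)"
    proof
      fix z assume z: "z \<in> {z. (SOME l. l \<in> I \<and> pmf (K (c l)) z > \<gamma> * pmf Q z) \<noteq> k}"
      show "z \<in> ?A \<union> (\<Union>l\<in>I - {k}. ?B l)"
      proof (rule ccontr)
        assume n: "z \<notin> ?A \<union> (\<Union>l\<in>I - {k}. ?B l)"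
        then have "(SOME l. l \<in> I \<and> pmf (K (c l)) z > \<gamma> * pmf Q z) = k"
          using k by (intro some_equality) (auto simp: not_le)
        with z show False by simp
      qed
    qed
    then have "err c k \<le> measure_pmf.prob (K (c k)) (?A \<union> (\<Union>l\<in>I - {k}. ?B l))"
      unfolding err_def by (intro measure_pmf.finite_measure_mono) auto
    also have "\<dots> \<le> miss (c k) + measure_pmf.prob (K (c k)) (\<Union>l\<in>I - {k}. ?B l)"
      unfolding miss_def by (intro measure_Un_le) auto
    also have "measure_pmf.prob (K (c k)) (\<Union>l\<in>I - {k}. ?B l) \<le> (\<Sum>l\<in>I - {k}. conf (c l) (c k))"
      unfolding conf_def using fI by (intro measure_UNION_le) auto
    finally show ?thesis by simp
  qed
  \<comment> \<open>Change of measure: once the sent word is averaged out the output has law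
    \<open>Q\<close>, and wherever \<open>v\<close> passes the test, \<open>pmf Q z\<close> is below
    \<open>pmf (K v) z / \<gamma>\<close>.\<close>
  have conf: "measure_pmf.expectation p (conf v) \<le> 1 / \<gamma>" for v
  proof -
    let ?A = "{z. pmf (K v) z > \<gamma> * pmf Q z}"
    have ind: "measure_pmf.prob q A = measure_pmf.expectation q (indicator A)" for q :: "'z pmf" and A
      by simp
    have "measure_pmf.expectation p (conf v) = measure_pmf.prob Q ?A"
      unfolding Q_def ind conf_def by (subst expectation_bind_pmf[where B=1]) (simp_all add: indicator_def)
    also have "\<dots> = (\<Sum>z\<in>set_pmf Q \<inter> ?A. pmf Q z)"
      using fQ by (subst measure_Int_set_pmf[symmetric], subst Int_commute) (simp add: measure_measure_pmf_finite)
    also have "\<dots> \<le> (\<Sum>z\<in>set_pmf Q \<inter> ?A. pmf (K v) z / \<gamma>)"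
      using \<gamma> by (intro sum_mono) (auto simp: field_simps)
    also have "\<dots> = measure_pmf.prob (K v) (set_pmf Q \<inter> ?A) / \<gamma>"
      using fQ by (simp add: measure_measure_pmf_finite sum_divide_distrib)
    also have "\<dots> \<le> 1 / \<gamma>"
      using \<gamma> by (intro divide_right_mono) auto
    finally show ?thesis .
  qed
  have "?E (\<lambda>c. (\<Sum>k\<in>I. err c k) / card I)
      \<le> ?E (\<lambda>c. (\<Sum>k\<in>I. miss (c k) + (\<Sum>l\<in>I - {k}. conf (c l) (c k))) / card I)"
    by (intro integral_mono intC divide_right_mono sum_mono ub) auto
  also have "\<dots> = (\<Sum>k\<in>I. ?E (\<lambda>c. miss (c k)) + (\<Sum>l\<in>I - {k}. ?E (\<lambda>c. conf (c l) (c k)))) / card I"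
    using intC by (simp add: Bochner_Integration.integral_sum)
  also have "\<dots> \<le> (\<Sum>k\<in>I. measure_pmf.expectation p miss + (\<Sum>l\<in>I - {k}. 1 / \<gamma>)) / card I"
  proof (intro divide_right_mono sum_mono add_mono)
    fix k assume k: "k \<in> I"
    show "?E (\<lambda>c. miss (c k)) \<le> measure_pmf.expectation p miss"
      using expectation_iid_component[of I' k d p miss] k I I' by auto
    fix l assume l: "l \<in> I - {k}"
    \<comment> \<open>The outer variable is the competing word and the inner one the sent word, so
      \<open>conf\<close> applies for each fixed competitor.\<close>
    have "?E (\<lambda>c. conf (c l) (c k)) = measure_pmf.expectation p (\<lambda>v. measure_pmf.expectation p (conf v))"
      using k l I I' fp by (intro expectation_iid_pair) auto
    also have "\<dots> \<le> measure_pmf.expectation p (\<lambda>v. 1 / \<gamma>)"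
      by (intro integral_mono int conf)
    finally show "?E (\<lambda>c. conf (c l) (c k)) \<le> 1 / \<gamma>" by simp
  qed simp
  also have "\<dots> \<le> (\<Sum>k\<in>I. measure_pmf.expectation p miss + card I / \<gamma>) / card I"
    using fI \<gamma> by (intro divide_right_mono sum_mono add_mono)
      (auto simp: field_simps card_Diff_singleton_if)
  also have "\<dots> = measure_pmf.expectation p miss + card I / \<gamma>"
    using N by simp
  also have "measure_pmf.expectation p miss
      = measure_pmf.prob (joint_pmf p K) {(u, z). pmf (K u) z \<le> \<gamma> * pmf Q z}"
    by (simp add: prob_joint_pmf miss_def[abs_def])
  finally show ?thesis
    by (simp add: err_def Q_def)
qed

section \<open>Codes from a fixed codebook\<close>

lemma pmf_joint_pmf: "pmf (joint_pmf p K) (a, b) = pmf p a * pmf (K a) b"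
proof -
  have "pmf (joint_pmf p K) (a, b) = measure_pmf.expectation p (\<lambda>a'. if a' = a then pmf (K a) b else 0)"
    unfolding joint_pmf_def pmf_bind
  proof (intro Bochner_Integration.integral_cong refl)
    fix a'
    have "measure_pmf.expectation (K a') (\<lambda>b'. pmf (return_pmf (a', b')) (a, b))
        = measure_pmf.expectation (K a') (\<lambda>b'. if a' = a then indicator {b} b' else 0)"
      by (intro Bochner_Integration.integral_cong refl) (auto simp: indicator_def)
    then show "measure_pmf.expectation (K a') (\<lambda>b'. pmf (return_pmf (a', b')) (a, b))
        = (if a' = a then pmf (K a) b else 0)"
      by (cases "a' = a") (simp_all add: pmf.rep_eq)
  qed
  also have "\<dots> = (\<Sum>a'\<in>{a}. (if a' = a then pmf (K a) b else 0) * pmf p a')"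
    by (intro integral_measure_pmf_real) (auto split: if_splits)
  finally show ?thesis by simp
qed

text \<open>\<open>L\<close> conditions on the first component. Where the first marginal vanishes
  \<open>cond_pmf\<close> is unspecified, but both sides are zero there. This yields the posterior
  used by the encoder and the factorization starting from \<open>u\<close>.\<close>

lemma disintegration:
  obtains L where "J = joint_pmf (map_pmf fst J) L"
proof
  define L where "L a = map_pmf snd (cond_pmf J {z. fst z = a})" for a
  show "J = joint_pmf (map_pmf fst J) L"
  proof (rule pmf_eqI)
    fix z :: "'a \<times> 'b"
    obtain a b where z: "z = (a, b)" by (cases z)
    show "pmf J z = pmf (joint_pmf (map_pmf fst J) L) z"
    proof (cases "a \<in> fst ` set_pmf J")
      case False
      then have "pmf J (a, b) = 0" "pmf (map_pmf fst J) a = 0"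
        by (auto simp: pmf_eq_0_set_pmf image_iff)
      then show ?thesis by (simp add: z pmf_joint_pmf)
    next
      case True
      let ?A = "{z. fst z = a}"
      have ne: "set_pmf J \<inter> ?A \<noteq> {}" using True by auto
      have "pmf (L a) b = measure_pmf.prob (cond_pmf J ?A) (snd -` {b})"
        by (simp add: L_def pmf_map)
      also have "\<dots> = measure_pmf.prob (cond_pmf J ?A) {(a, b)}"
        by (rule measure_prob_cong_0) (auto simp: pmf_cond[OF ne])
      also have "\<dots> = pmf J (a, b) / measure_pmf.prob J ?A"
        by (simp add: measure_pmf_single pmf_cond[OF ne])
      finally have "pmf (L a) b = pmf J (a, b) / measure_pmf.prob J ?A" .
      moreover have "pmf (map_pmf fst J) a = measure_pmf.prob J ?A"
        by (simp add: pmf_map vimage_def)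
      moreover have "measure_pmf.prob J ?A \<noteq> 0"
        using ne by (simp add: measure_measure_pmf_not_zero)
      ultimately show ?thesis by (simp add: z pmf_joint_pmf)
    qed
  qed
qed

text \<open>\<open>L x \<omega>\<close> is the posterior of the index \<open>k\<close> given \<open>x\<close>; applying the same kernel to both joint laws of
  \<open>(x, k)\<close> reduces the encoding error to the distance of their \<open>x\<close>-marginals.\<close>

lemma one_shot_code:
  fixes KX :: "'u \<Rightarrow> 'x pmf" and KE :: "'u \<Rightarrow> 'x \<Rightarrow> 'xt pmf" and W :: "'xt \<Rightarrow> 'yt pmf"
    and D :: "'yt \<Rightarrow> 'u \<Rightarrow> 'y pmf" and c :: "'k \<Rightarrow> 'u" and I :: "'w \<Rightarrow> 'k set"
    and g :: "'yt \<Rightarrow> 'w \<Rightarrow> 'k"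
  assumes \<Omega>: "finite \<Omega>" "\<Omega> \<noteq> {}" and I: "\<And>\<omega>. finite (I \<omega>)" "\<And>\<omega>. I \<omega> \<noteq> {}"
  obtains L where
    "tv_dist
      (do {x \<leftarrow> pX; \<omega> \<leftarrow> pmf_of_set \<Omega>; xt \<leftarrow> bind_pmf (L x \<omega>) (\<lambda>k. KE (c k) x); yt \<leftarrow> W xt;
           y \<leftarrow> D yt (c (g yt \<omega>)); return_pmf (x, y)}) T
     \<le> (\<Sum>\<omega>\<in>\<Omega>. tv_dist (bind_pmf (pmf_of_set (I \<omega>)) (\<lambda>k. KX (c k))) pX) / card \<Omega>
      + (\<Sum>\<omega>\<in>\<Omega>. (\<Sum>k\<in>I \<omega>. measure_pmf.prob (do {x \<leftarrow> KX (c k); xt \<leftarrow> KE (c k) x; W xt})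
          {yt. g yt \<omega> \<noteq> k}) / card (I \<omega>)) / card \<Omega>
      + tv_dist (do {\<omega> \<leftarrow> pmf_of_set \<Omega>; k \<leftarrow> pmf_of_set (I \<omega>); x \<leftarrow> KX (c k); xt \<leftarrow> KE (c k) x;
          yt \<leftarrow> W xt; y \<leftarrow> D yt (c k); return_pmf (x, y)}) T"
proof -
  define PX where "PX \<omega> = bind_pmf (pmf_of_set (I \<omega>)) (\<lambda>k. KX (c k))" for \<omega>
  define A where "A \<omega> = do {k \<leftarrow> pmf_of_set (I \<omega>); x \<leftarrow> KX (c k); return_pmf (x, k)}" for \<omega>
  have "map_pmf fst (A \<omega>) = PX \<omega>" for \<omega>
    by (simp add: A_def PX_def map_bind_pmf bind_return_pmf')
  then have "\<exists>L. A \<omega> = joint_pmf (PX \<omega>) L" for \<omega>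
    using disintegration[of "A \<omega>"] by metis
  then obtain L' where L': "\<And>\<omega>. A \<omega> = joint_pmf (PX \<omega>) (L' \<omega>)"
    by metis
  \<comment> \<open>\<open>H\<close> stops just before the decoder. \<open>F\<close> continues with
    the decoded index and \<open>G\<close> with the true one, so they agree whenever
    \<open>g yt \<omega> = k\<close>.\<close>
  define H where "H k x = do {xt \<leftarrow> KE (c k) x; yt \<leftarrow> W xt; return_pmf (x, yt)}" for k x
  define F where "F \<omega> = (\<lambda>(x :: 'x, yt). do {y \<leftarrow> D yt (c (g yt \<omega>)); return_pmf (x, y)})" for \<omega>
  define G where "G k = (\<lambda>(x :: 'x, yt). do {y \<leftarrow> D yt (c k); return_pmf (x, y)})" for k
  \<comment> \<open>Three hybrids: \<open>?sim\<close> takes \<open>x\<close> from the source and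
    the index from the posterior; \<open>?mid\<close> takes a uniform index and \<open>x\<close>
    from its word; \<open>?ideal\<close> moreover tells the decoder the true index.\<close>
  let ?sim = "bind_pmf (pmf_of_set \<Omega>) (\<lambda>\<omega>. bind_pmf (joint_pmf pX (L' \<omega>)) (\<lambda>(x, k). bind_pmf (H k x) (F \<omega>)))"
  let ?mid = "bind_pmf (pmf_of_set \<Omega>) (\<lambda>\<omega>. bind_pmf (A \<omega>) (\<lambda>(x, k). bind_pmf (H k x) (F \<omega>)))"
  let ?ideal = "bind_pmf (pmf_of_set \<Omega>) (\<lambda>\<omega>. bind_pmf (A \<omega>) (\<lambda>(x, k). bind_pmf (H k x) (G k)))"
  \<comment> \<open>Source and shared randomness are independent, so \<open>\<omega>\<close> may be
    drawn first and the estimates made for each fixed \<open>\<omega>\<close>.\<close>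
  have sim: "do {x \<leftarrow> pX; \<omega> \<leftarrow> pmf_of_set \<Omega>; xt \<leftarrow> bind_pmf (L' \<omega> x) (\<lambda>k. KE (c k) x); yt \<leftarrow> W xt;
           y \<leftarrow> D yt (c (g yt \<omega>)); return_pmf (x, y)} = ?sim"
    by (subst bind_commute_pmf)
       (simp add: joint_pmf_def H_def F_def bind_assoc_pmf bind_return_pmf)
  have ideal: "do {\<omega> \<leftarrow> pmf_of_set \<Omega>; k \<leftarrow> pmf_of_set (I \<omega>); x \<leftarrow> KX (c k); xt \<leftarrow> KE (c k) x;
          yt \<leftarrow> W xt; y \<leftarrow> D yt (c k); return_pmf (x, y)} = ?ideal"
    by (simp add: A_def H_def G_def bind_assoc_pmf bind_return_pmf)
  have "tv_dist ?sim ?mid \<le> measure_pmf.expectation (pmf_of_set \<Omega>) (\<lambda>\<omega>.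
      tv_dist (bind_pmf (joint_pmf pX (L' \<omega>)) (\<lambda>(x, k). bind_pmf (H k x) (F \<omega>)))
        (bind_pmf (A \<omega>) (\<lambda>(x, k). bind_pmf (H k x) (F \<omega>))))"
    by (rule tv_dist_bind_right)
  also have "\<dots> = (\<Sum>\<omega>\<in>\<Omega>.
      tv_dist (bind_pmf (joint_pmf pX (L' \<omega>)) (\<lambda>(x, k). bind_pmf (H k x) (F \<omega>)))
        (bind_pmf (A \<omega>) (\<lambda>(x, k). bind_pmf (H k x) (F \<omega>)))) / card \<Omega>"
    using \<Omega> by (simp add: integral_pmf_of_set)
  also have "\<dots> \<le> (\<Sum>\<omega>\<in>\<Omega>. tv_dist (PX \<omega>) pX) / card \<Omega>"
  proof (intro divide_right_mono sum_mono)
    fix \<omega>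
    have "tv_dist (bind_pmf (joint_pmf pX (L' \<omega>)) (\<lambda>(x, k). bind_pmf (H k x) (F \<omega>)))
        (bind_pmf (A \<omega>) (\<lambda>(x, k). bind_pmf (H k x) (F \<omega>))) \<le> tv_dist (joint_pmf pX (L' \<omega>)) (A \<omega>)"
      by (rule tv_dist_bind_left)
    also have "\<dots> \<le> tv_dist pX (PX \<omega>)"
      unfolding L' joint_pmf_def by (rule tv_dist_bind_left)
    finally show "tv_dist (bind_pmf (joint_pmf pX (L' \<omega>)) (\<lambda>(x, k). bind_pmf (H k x) (F \<omega>)))
        (bind_pmf (A \<omega>) (\<lambda>(x, k). bind_pmf (H k x) (F \<omega>))) \<le> tv_dist (PX \<omega>) pX"
      by (simp add: tv_dist_commute)
  qed simp
  finally have 1: "tv_dist ?sim ?mid \<le> (\<Sum>\<omega>\<in>\<Omega>. tv_dist (PX \<omega>) pX) / card \<Omega>" .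
  have err: "tv_dist (bind_pmf (A \<omega>) (\<lambda>(x, k). bind_pmf (H k x) (F \<omega>)))
      (bind_pmf (A \<omega>) (\<lambda>(x, k). bind_pmf (H k x) (G k)))
    \<le> (\<Sum>k\<in>I \<omega>. measure_pmf.prob (do {x \<leftarrow> KX (c k); xt \<leftarrow> KE (c k) x; W xt})
          {yt. g yt \<omega> \<noteq> k}) / card (I \<omega>)" for \<omega>
  proof -
    have A: "bind_pmf (A \<omega>) (\<lambda>(x, k). bind_pmf (H k x) (Z k))
        = bind_pmf (pmf_of_set (I \<omega>)) (\<lambda>k. bind_pmf (bind_pmf (KX (c k)) (H k)) (Z k))"
      for Z :: "'k \<Rightarrow> 'x \<times> 'yt \<Rightarrow> ('x \<times> 'y) pmf"
      by (simp add: A_def bind_assoc_pmf bind_return_pmf)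
    have "tv_dist (bind_pmf (A \<omega>) (\<lambda>(x, k). bind_pmf (H k x) (F \<omega>)))
        (bind_pmf (A \<omega>) (\<lambda>(x, k). bind_pmf (H k x) (G k)))
      \<le> measure_pmf.expectation (pmf_of_set (I \<omega>)) (\<lambda>k.
          tv_dist (bind_pmf (bind_pmf (KX (c k)) (H k)) (F \<omega>)) (bind_pmf (bind_pmf (KX (c k)) (H k)) (G k)))"
      unfolding A by (rule tv_dist_bind_right)
    also have "\<dots> = (\<Sum>k\<in>I \<omega>.
          tv_dist (bind_pmf (bind_pmf (KX (c k)) (H k)) (F \<omega>)) (bind_pmf (bind_pmf (KX (c k)) (H k)) (G k))) / card (I \<omega>)"
      using I by (simp add: integral_pmf_of_set)
    also have "\<dots> \<le> (\<Sum>k\<in>I \<omega>. measure_pmf.prob (do {x \<leftarrow> KX (c k); xt \<leftarrow> KE (c k) x; W xt})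
          {yt. g yt \<omega> \<noteq> k}) / card (I \<omega>)"
    proof (intro divide_right_mono sum_mono)
      fix k
      let ?P = "bind_pmf (KX (c k)) (H k)"
      have "tv_dist (bind_pmf ?P (F \<omega>)) (bind_pmf ?P (G k))
          \<le> measure_pmf.expectation ?P (\<lambda>z. tv_dist (F \<omega> z) (G k z))"
        by (rule tv_dist_bind_right)
      also have "\<dots> \<le> measure_pmf.expectation ?P (indicator {z. g (snd z) \<omega> \<noteq> k})"
      proof (intro integral_mono)
        show "integrable (measure_pmf ?P) (\<lambda>z. tv_dist (F \<omega> z) (G k z))"
          by (intro measure_pmf.integrable_const_bound[where B=1])
             (simp_all add: tv_dist_nonneg tv_dist_le_1)
        fix z
        show "tv_dist (F \<omega> z) (G k z) \<le> indicator {z. g (snd z) \<omega> \<noteq> k} z"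
          by (cases z) (auto simp: F_def G_def tv_dist_self tv_dist_le_1 indicator_def)
        show "integrable (measure_pmf ?P) (indicator {z. g (snd z) \<omega> \<noteq> k} :: _ \<Rightarrow> real)"
          by (intro measure_pmf.integrable_const_bound[where B=1]) (simp_all add: indicator_def)
      qed
      also have "\<dots> = measure_pmf.prob (map_pmf snd ?P) {yt. g yt \<omega> \<noteq> k}"
        by (simp add: vimage_def)
      also have "map_pmf snd ?P = do {x \<leftarrow> KX (c k); xt \<leftarrow> KE (c k) x; W xt}"
        by (simp add: H_def map_bind_pmf bind_return_pmf')
      finally show "tv_dist (bind_pmf ?P (F \<omega>)) (bind_pmf ?P (G k))
          \<le> measure_pmf.prob (do {x \<leftarrow> KX (c k); xt \<leftarrow> KE (c k) x; W xt}) {yt. g yt \<omega> \<noteq> k}" .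
    qed simp
    finally show ?thesis .
  qed
  have "tv_dist ?mid ?ideal \<le> measure_pmf.expectation (pmf_of_set \<Omega>) (\<lambda>\<omega>.
      tv_dist (bind_pmf (A \<omega>) (\<lambda>(x, k). bind_pmf (H k x) (F \<omega>)))
        (bind_pmf (A \<omega>) (\<lambda>(x, k). bind_pmf (H k x) (G k))))"
    by (rule tv_dist_bind_right)
  also have "\<dots> = (\<Sum>\<omega>\<in>\<Omega>.
      tv_dist (bind_pmf (A \<omega>) (\<lambda>(x, k). bind_pmf (H k x) (F \<omega>)))
        (bind_pmf (A \<omega>) (\<lambda>(x, k). bind_pmf (H k x) (G k)))) / card \<Omega>"
    using \<Omega> by (simp add: integral_pmf_of_set)
  also have "\<dots> \<le> (\<Sum>\<omega>\<in>\<Omega>. (\<Sum>k\<in>I \<omega>. measure_pmf.prob (do {x \<leftarrow> KX (c k); xt \<leftarrow> KE (c k) x; W xt})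
          {yt. g yt \<omega> \<noteq> k}) / card (I \<omega>)) / card \<Omega>"
    by (intro divide_right_mono sum_mono err) simp
  finally have 2: "tv_dist ?mid ?ideal \<le> \<dots>" .
  have "tv_dist ?sim T \<le> tv_dist ?sim ?mid + (tv_dist ?mid ?ideal + tv_dist ?ideal T)"
    using tv_dist_triangle[of ?sim T ?mid] tv_dist_triangle[of ?mid T ?ideal] by linarith
  with 1 2 show thesis
    by (intro that[of "\<lambda>x \<omega>. L' \<omega> x"]) (simp add: sim ideal PX_def[abs_def])
qed

section \<open>Mutual information and information density\<close>

lemma
  fixes P :: "'a pmf" and A :: "'a \<Rightarrow> 'b::finite" and B :: "'a \<Rightarrow> 'c::finite"
  defines "J \<equiv> map_pmf (\<lambda>s. (A s, B s)) P"
  shows mutual_info_eq: "mutual_info P A B = measure_pmf.expectation J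
      (\<lambda>z. log 2 (pmf J z / (pmf (map_pmf A P) (fst z) * pmf (map_pmf B P) (snd z))))"
    and mutual_info_nonneg: "mutual_info P A B \<ge> 0"
proof -
  interpret information_space "measure_pmf P" 2
    by unfold_locales simp
  have dist: "distributed (measure_pmf P) (count_space UNIV) X (\<lambda>x. ennreal (pmf (map_pmf X P) x))"
    for X :: "'a \<Rightarrow> 'd"
  proof -
    have "distr (measure_pmf P) (count_space UNIV) X = density (count_space UNIV) (pmf (map_pmf X P))"
      unfolding map_pmf_rep_eq[symmetric] by (rule measure_pmf_eq_density)
    then show ?thesis by (simp add: distributed_def)
  qed
  have cs: "count_space UNIV \<Otimes>\<^sub>M count_space UNIV = (count_space UNIV :: ('b \<times> 'c) measure)"
    by (simp add: pair_measure_count_space)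
  have sf: "sigma_finite_measure (count_space (UNIV :: 'b set))" "sigma_finite_measure (count_space (UNIV :: 'c set))"
    by (simp_all add: sigma_finite_measure_count_space_finite)
  have distJ: "distributed (measure_pmf P) (count_space UNIV \<Otimes>\<^sub>M count_space UNIV) (\<lambda>s. (A s, B s)) (\<lambda>x. ennreal (pmf J x))"
    unfolding cs J_def by (rule dist)
  have "mutual_info P A B = (\<integral>x. pmf J x * log 2 (pmf J x / (pmf (map_pmf A P) (fst x) * pmf (map_pmf B P) (snd x))) \<partial>(count_space UNIV \<Otimes>\<^sub>M count_space UNIV))"
    unfolding mutual_info_def
    by (rule mutual_information_distr[OF sf dist _ dist _ distJ]) simp_all
  also have "\<dots> = (\<Sum>x\<in>UNIV. log 2 (pmf J x / (pmf (map_pmf A P) (fst x) * pmf (map_pmf B P) (snd x))) * pmf J x)"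
    unfolding cs by (simp add: lebesgue_integral_count_space_finite mult.commute)
  also have "\<dots> = measure_pmf.expectation J (\<lambda>z. log 2 (pmf J z / (pmf (map_pmf A P) (fst z) * pmf (map_pmf B P) (snd z))))"
    by (rule integral_measure_pmf_real[symmetric]) simp_all
  finally show "mutual_info P A B = \<dots>" .
  show "mutual_info P A B \<ge> 0"
    unfolding mutual_info_def
    by (rule mutual_information_nonneg[OF sf dist _ dist _ distJ])
       (simp_all add: cs integrable_count_space)
qed

text \<open>Where a mass vanishes, \<open>log 2 0 = 0\<close> gives a junk value; such points lie outside the support of
  \<open>joint_pmf p K\<close>.\<close>

definition info_density :: "'u pmf \<Rightarrow> ('u \<Rightarrow> 'z pmf) \<Rightarrow> 'u \<times> 'z \<Rightarrow> real" where
  "info_density p K = (\<lambda>(u, z). log 2 (pmf (K u) z / pmf (bind_pmf p K) z))"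

lemma map_fst_joint_pmf: "map_pmf fst (joint_pmf p K) = p"
  by (simp add: joint_pmf_def map_bind_pmf map_pmf_def[symmetric])
     (simp add: map_pmf_def bind_assoc_pmf bind_return_pmf bind_return_pmf')

lemma map_snd_joint_pmf: "map_pmf snd (joint_pmf p K) = bind_pmf p K"
  by (simp add: joint_pmf_def map_bind_pmf bind_return_pmf')

text \<open>The joint law is \<open>p\<close> times the kernel, so \<open>pmf p u\<close> cancels
  inside the logarithm on the support. Mutual information thus becomes the mean to which the weak
  law refers.\<close>

lemma mutual_info_conv_info_density:
  fixes A :: "'a \<Rightarrow> 'b::finite" and B :: "'a \<Rightarrow> 'c::finite"
  assumes J: "map_pmf (\<lambda>s. (A s, B s)) P = joint_pmf p K"
  shows "mutual_info P A B = measure_pmf.expectation (joint_pmf p K) (info_density p K)"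
proof -
  have A: "map_pmf A P = p"
    using map_fst_joint_pmf[of p K] unfolding J[symmetric] by (simp add: map_pmf_comp)
  have B: "map_pmf B P = bind_pmf p K"
    using map_snd_joint_pmf[of p K] unfolding J[symmetric] by (simp add: map_pmf_comp)
  have "mutual_info P A B = measure_pmf.expectation (joint_pmf p K)
      (\<lambda>z. log 2 (pmf (joint_pmf p K) z / (pmf p (fst z) * pmf (bind_pmf p K) (snd z))))"
    unfolding mutual_info_eq J A B ..
  also have "\<dots> = measure_pmf.expectation (joint_pmf p K) (info_density p K)"
  proof (intro integral_cong_AE AE_pmfI)
    fix z assume "z \<in> set_pmf (joint_pmf p K)"
    then have "pmf p (fst z) \<noteq> 0"
      using map_fst_joint_pmf[of p K] by (metis image_eqI pmf_eq_0_set_pmf set_map_pmf)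
    then show "log 2 (pmf (joint_pmf p K) z / (pmf p (fst z) * pmf (bind_pmf p K) (snd z)))
        = info_density p K z"
      by (cases z) (simp add: pmf_joint_pmf info_density_def)
  qed auto
  finally show ?thesis .
qed

section \<open>Product pmfs and concentration\<close>

text \<open>Product laws of pairs live on sequences of pairs, codes on pairs of sequences.
  \<open>restrict\<close> restores the default \<open>undefined\<close> beyond the first
  \<open>n\<close> entries.\<close>

definition unzip_seq :: "nat \<Rightarrow> (nat \<Rightarrow> 'a \<times> 'b) \<Rightarrow> (nat \<Rightarrow> 'a) \<times> (nat \<Rightarrow> 'b)" where
  "unzip_seq n f = (restrict (\<lambda>i. fst (f i)) {..<n}, restrict (\<lambda>i. snd (f i)) {..<n})"

lemma set_Pi_pmf_undefined_eq_restrict: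
  assumes "f \<in> set_pmf (Pi_pmf A undefined p)" "finite A"
  shows "restrict f A = f"
  using assms set_Pi_pmf_subset[of A undefined p] by (auto simp: restrict_def fun_eq_iff)

text \<open>The factors may depend on the position: constant ones give the i.i.d. case, and factors
  depending on \<open>u i\<close> give the outputs for a fixed codeword \<open>u\<close>. The
  default \<open>d\<close> is arbitrary since \<open>unzip_seq\<close> overwrites it.\<close>

lemma joint_pmf_Pi_pmf:
  "joint_pmf (Pi_pmf {..<n} undefined p) (\<lambda>a. Pi_pmf {..<n} undefined (\<lambda>i. q i (a i)))
    = map_pmf (unzip_seq n) (Pi_pmf {..<n} d (\<lambda>i. joint_pmf (p i) (q i)))"
proof -
  have "map_pmf (unzip_seq n) (Pi_pmf {..<n} d (\<lambda>i. joint_pmf (p i) (q i)))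
    = do {a \<leftarrow> Pi_pmf {..<n} undefined p; b \<leftarrow> Pi_pmf {..<n} undefined (\<lambda>i. q i (a i));
        return_pmf (unzip_seq n (\<lambda>i. if i \<in> {..<n} then (a i, b i) else d))}"
    unfolding joint_pmf_def
    by (simp add: Pi_pmf_bind[where d'=undefined] map_bind_pmf)
  also have "\<dots> = joint_pmf (Pi_pmf {..<n} undefined p) (\<lambda>a. Pi_pmf {..<n} undefined (\<lambda>i. q i (a i)))"
    unfolding joint_pmf_def
  proof (intro bind_pmf_cong refl)
    fix a b
    assume a: "a \<in> set_pmf (Pi_pmf {..<n} undefined p)"
      and b: "b \<in> set_pmf (Pi_pmf {..<n} undefined (\<lambda>i. q i (a i)))"
    have "unzip_seq n (\<lambda>i. if i \<in> {..<n} then (a i, b i) else d) = (restrict a {..<n}, restrict b {..<n})"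
      by (auto simp: unzip_seq_def fun_eq_iff)
    then show "return_pmf (unzip_seq n (\<lambda>i. if i \<in> {..<n} then (a i, b i) else d)) = return_pmf (a, b)"
      using set_Pi_pmf_undefined_eq_restrict[OF a] set_Pi_pmf_undefined_eq_restrict[OF b] by simp
  qed
  finally show ?thesis ..
qed

lemma joint_pmf_iid_memoryless:
  "joint_pmf (iid_pmf n p) (memoryless n K) = map_pmf (unzip_seq n) (iid_pmf n (joint_pmf p K))"
  unfolding iid_pmf_def memoryless_def by (rule joint_pmf_Pi_pmf)

lemma bind_iid_memoryless: "bind_pmf (iid_pmf n p) (memoryless n K) = iid_pmf n (bind_pmf p K)"
  unfolding iid_pmf_def memoryless_def by (rule Pi_pmf_bind[symmetric]) simp

text \<open>Both laws are products, so the likelihood ratio multiplies over positions. On the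
  support all factors are positive and every logarithm is genuine.\<close>

lemma pmf_memoryless_conv_info_density:
  assumes f: "f \<in> set_pmf (iid_pmf n (joint_pmf p K))" and uz: "unzip_seq n f = (u, z)"
  shows "pmf (memoryless n K u) z
      = 2 powr (\<Sum>i<n. info_density p K (f i)) * pmf (bind_pmf (iid_pmf n p) (memoryless n K)) z"
    and "pmf (bind_pmf (iid_pmf n p) (memoryless n K)) z > 0"
proof -
  have u: "u i = fst (f i)" and z: "z i = snd (f i)" if "i < n" for i
    using uz that by (auto simp: unzip_seq_def)
  have z': "z i = undefined" if "i \<notin> {..<n}" for i
    using uz that by (auto simp: unzip_seq_def)
  have fi: "f i \<in> set_pmf (joint_pmf p K)" if "i < n" for i
    using f that by (auto simp: iid_pmf_def set_Pi_pmf PiE_dflt_def)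
  have pos: "pmf (K (fst (f i))) (snd (f i)) > 0" "pmf (bind_pmf p K) (snd (f i)) > 0" if "i < n" for i
    using fi[OF that] by (auto simp: joint_pmf_def pmf_positive_iff)
  have Q: "pmf (bind_pmf (iid_pmf n p) (memoryless n K)) z = (\<Prod>i<n. pmf (bind_pmf p K) (snd (f i)))"
    unfolding bind_iid_memoryless unfolding iid_pmf_def
    by (subst pmf_Pi') (auto simp: z z')
  show "pmf (bind_pmf (iid_pmf n p) (memoryless n K)) z > 0"
    unfolding Q using pos by (auto intro!: prod_pos)
  have "pmf (memoryless n K u) z = (\<Prod>i<n. pmf (K (fst (f i))) (snd (f i)))"
    unfolding memoryless_def
    by (subst pmf_Pi') (auto simp: u z z')
  also have "\<dots> = (\<Prod>i<n. 2 powr info_density p K (f i) * pmf (bind_pmf p K) (snd (f i)))"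
  proof (intro prod.cong refl)
    fix i assume "i \<in> {..<n}"
    then show "pmf (K (fst (f i))) (snd (f i)) = 2 powr info_density p K (f i) * pmf (bind_pmf p K) (snd (f i))"
      using pos[of i] by (simp add: info_density_def case_prod_beta')
  qed
  also have "\<dots> = 2 powr (\<Sum>i<n. info_density p K (f i)) * pmf (bind_pmf (iid_pmf n p) (memoryless n K)) z"
    by (simp add: Q prod.distrib powr_sum)
  finally show "pmf (memoryless n K u) z
      = 2 powr (\<Sum>i<n. info_density p K (f i)) * pmf (bind_pmf (iid_pmf n p) (memoryless n K)) z" .
qed

text \<open>Chebyshev's inequality, with the second-moment bound for codebooks reused for the
  positions of one sequence.\<close>

lemma weak_law_iid:
  fixes \<phi> :: "'a \<Rightarrow> real"
  assumes fJ: "finite (set_pmf J)" and \<delta>: "\<delta> > 0"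
  shows "(\<lambda>n. measure_pmf.prob (iid_pmf n J)
      {f. \<bar>(\<Sum>i<n. \<phi> (f i)) / n - measure_pmf.expectation J \<phi>\<bar> \<ge> \<delta>}) \<longlonglongrightarrow> 0"
proof -
  define m where "m = measure_pmf.expectation J \<phi>"
  define B where "B = measure_pmf.expectation J (\<lambda>x. (\<phi> x)\<^sup>2)"
  have bound: "measure_pmf.prob (iid_pmf n J) {f. \<bar>(\<Sum>i<n. \<phi> (f i)) / n - m\<bar> \<ge> \<delta>} \<le> B / \<delta>\<^sup>2 / n"
    if n: "n > 0" for n :: nat
  proof -
    have int: "integrable (measure_pmf (iid_pmf n J)) f" for f :: "_ \<Rightarrow> real"
      unfolding iid_pmf_def using fJ by (intro integrable_measure_pmf_finite finite_set_Pi_pmf) auto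
    have "measure_pmf.prob (iid_pmf n J) {f. \<bar>(\<Sum>i<n. \<phi> (f i)) / n - m\<bar> \<ge> \<delta>}
        = measure_pmf.expectation (iid_pmf n J) (indicator {f. \<bar>(\<Sum>i<n. \<phi> (f i)) / n - m\<bar> \<ge> \<delta>})"
      by simp
    also have "\<dots> \<le> measure_pmf.expectation (iid_pmf n J) (\<lambda>f. ((\<Sum>i<n. \<phi> (f i)) / n - m)\<^sup>2 / \<delta>\<^sup>2)"
    proof (intro integral_mono int)
      fix f :: "nat \<Rightarrow> 'a"
      let ?a = "(\<Sum>i<n. \<phi> (f i)) / n - m"
      have "\<delta> \<le> \<bar>?a\<bar> \<Longrightarrow> 1 \<le> ?a\<^sup>2 / \<delta>\<^sup>2"
        using \<delta> by (simp add: abs_le_square_iff[symmetric])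
      then show "indicator {f. \<bar>(\<Sum>i<n. \<phi> (f i)) / n - m\<bar> \<ge> \<delta>} f \<le> ?a\<^sup>2 / \<delta>\<^sup>2"
        by (auto simp: indicator_def)
    qed
    also have "\<dots> = measure_pmf.expectation (iid_pmf n J) (\<lambda>f. ((\<Sum>i<n. \<phi> (f i)) / n - m)\<^sup>2) / \<delta>\<^sup>2"
      by simp
    also have "\<dots> \<le> (B / n) / \<delta>\<^sup>2"
      using second_moment_iid_average[OF fJ, of "{..<n}" "{..<n}" undefined \<phi>] n
      by (intro divide_right_mono) (auto simp: iid_pmf_def B_def m_def)
    finally show ?thesis by (simp add: mult.commute)
  qed
  show ?thesis
    unfolding m_def[symmetric]
    by (rule tendsto_sandwich[OF _ _ tendsto_const lim_const_over_n[of "B / \<delta>\<^sup>2"]])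
       (use bound in \<open>auto intro!: eventually_sequentiallyI[of 1]\<close>)
qed

lemma powr_threshold_iff:
  fixes r s q :: real
  assumes "q > 0" "n > 0"
  shows "2 powr (real n * r) * q < 2 powr s * q \<longleftrightarrow> r < s / n"
    and "2 powr s * q \<le> 2 powr (real n * r) * q \<longleftrightarrow> s / n \<le> r"
  using assms by (auto simp: mult_less_cancel_right_pos mult_le_cancel_right_pos pos_less_divide_eq
      pos_divide_le_eq mult.commute)

text \<open>After taking logarithms, either event puts the empirical mean of the information density
  on the far side of \<open>r\<close> from its expectation \<open>I\<close>, a deviation of at least
  \<open>\<bar>r - I\<bar>\<close>. The upper tail is the one in soft covering, the lower tail the
  one in decoding.\<close>

lemma
  fixes p :: "'u::finite pmf" and K :: "'u \<Rightarrow> 'z::finite pmf"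
  defines "I \<equiv> measure_pmf.expectation (joint_pmf p K) (info_density p K)"
  shows prob_info_density_above:
    "r > I \<Longrightarrow> (\<lambda>n. measure_pmf.prob (joint_pmf (iid_pmf n p) (memoryless n K)) {(u, z).
        pmf (memoryless n K u) z
          > 2 powr (real n * r) * pmf (bind_pmf (iid_pmf n p) (memoryless n K)) z}) \<longlonglongrightarrow> 0" (is "_ \<Longrightarrow> ?A")
    and prob_info_density_below:
    "r < I \<Longrightarrow> (\<lambda>n. measure_pmf.prob (joint_pmf (iid_pmf n p) (memoryless n K)) {(u, z).
        pmf (memoryless n K u) z
          \<le> 2 powr (real n * r) * pmf (bind_pmf (iid_pmf n p) (memoryless n K)) z}) \<longlonglongrightarrow> 0" (is "_ \<Longrightarrow> ?B")
proof -
  let ?J = "joint_pmf p K"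
  let ?i = "info_density p K"
  have lim: "(\<lambda>n. measure_pmf.prob (joint_pmf (iid_pmf n p) (memoryless n K)) (S n)) \<longlonglongrightarrow> 0"
    if "r \<noteq> I" and sub: "\<And>n f. n > 0 \<Longrightarrow> f \<in> set_pmf (iid_pmf n ?J) \<Longrightarrow> unzip_seq n f \<in> S n \<Longrightarrow>
      \<bar>(\<Sum>i<n. ?i (f i)) / n - I\<bar> \<ge> \<bar>r - I\<bar>" for S r
  proof -
    have "measure_pmf.prob (joint_pmf (iid_pmf n p) (memoryless n K)) (S n)
        \<le> measure_pmf.prob (iid_pmf n ?J) {f. \<bar>(\<Sum>i<n. ?i (f i)) / n - I\<bar> \<ge> \<bar>r - I\<bar>}" if "n > 0" for n
    proof -
      have "measure_pmf.prob (joint_pmf (iid_pmf n p) (memoryless n K)) (S n)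
          = measure_pmf.prob (iid_pmf n ?J) (unzip_seq n -` S n)"
        by (simp add: joint_pmf_iid_memoryless)
      also have "\<dots> \<le> measure_pmf.prob (iid_pmf n ?J) {f. \<bar>(\<Sum>i<n. ?i (f i)) / n - I\<bar> \<ge> \<bar>r - I\<bar>}"
        using sub[OF that] by (intro measure_pmf.finite_measure_mono_AE AE_pmfI) auto
      finally show ?thesis .
    qed
    note le = this
    have "(\<lambda>n. measure_pmf.prob (iid_pmf n ?J)
        {f. \<bar>(\<Sum>i<n. ?i (f i)) / n - I\<bar> \<ge> \<bar>r - I\<bar>}) \<longlonglongrightarrow> 0"
      unfolding I_def by (rule weak_law_iid) (use \<open>r \<noteq> I\<close> in \<open>simp_all add: I_def\<close>)
    from tendsto_sandwich[OF _ eventually_sequentiallyI[of 1] tendsto_const this] le show ?thesis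
      by simp
  qed
  have iff: "unzip_seq n f \<in> {(u, z). pmf (memoryless n K u) z
          > 2 powr (real n * r) * pmf (bind_pmf (iid_pmf n p) (memoryless n K)) z}
      \<longleftrightarrow> (\<Sum>i<n. ?i (f i)) / n > r"
    "unzip_seq n f \<in> {(u, z). pmf (memoryless n K u) z
          \<le> 2 powr (real n * r) * pmf (bind_pmf (iid_pmf n p) (memoryless n K)) z}
      \<longleftrightarrow> (\<Sum>i<n. ?i (f i)) / n \<le> r"
    if "n > 0" "f \<in> set_pmf (iid_pmf n ?J)" for n f r
  proof -
    obtain u z where uz: "unzip_seq n f = (u, z)" by fastforce
    note * = pmf_memoryless_conv_info_density[OF that(2) uz]
    show "unzip_seq n f \<in> {(u, z). pmf (memoryless n K u) z
          > 2 powr (real n * r) * pmf (bind_pmf (iid_pmf n p) (memoryless n K)) z}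
      \<longleftrightarrow> (\<Sum>i<n. ?i (f i)) / n > r"
      "unzip_seq n f \<in> {(u, z). pmf (memoryless n K u) z
          \<le> 2 powr (real n * r) * pmf (bind_pmf (iid_pmf n p) (memoryless n K)) z}
      \<longleftrightarrow> (\<Sum>i<n. ?i (f i)) / n \<le> r"
      unfolding uz mem_Collect_eq prod.case *(1)
      by (rule powr_threshold_iff[OF *(2) that(1)])+
  qed
  show ?A if r: "r > I"
  proof (rule lim[of r])
    fix n f assume *: "n > 0" "f \<in> set_pmf (iid_pmf n ?J)"
      "unzip_seq n f \<in> {(u, z). pmf (memoryless n K u) z
          > 2 powr (real n * r) * pmf (bind_pmf (iid_pmf n p) (memoryless n K)) z}"
    show "\<bar>(\<Sum>i<n. ?i (f i)) / n - I\<bar> \<ge> \<bar>r - I\<bar>"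
      using iff(1)[OF *(1,2), of r] *(3) r by linarith
  qed (use r in simp)
  show ?B if r: "r < I"
  proof (rule lim[of r])
    fix n f assume *: "n > 0" "f \<in> set_pmf (iid_pmf n ?J)"
      "unzip_seq n f \<in> {(u, z). pmf (memoryless n K u) z
          \<le> 2 powr (real n * r) * pmf (bind_pmf (iid_pmf n p) (memoryless n K)) z}"
    show "\<bar>(\<Sum>i<n. ?i (f i)) / n - I\<bar> \<ge> \<bar>r - I\<bar>"
      using iff(2)[OF *(1,2), of r] *(3) r by linarith
  qed (use r in simp)
qed

section \<open>Achievability\<close>

lemma exists_le_expectation:
  fixes f :: "'a \<Rightarrow> real"
  assumes "finite (set_pmf p)"
  shows "\<exists>x. f x \<le> measure_pmf.expectation p f"
proof (rule ccontr)
  assume "\<not> ?thesis"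
  then have less: "measure_pmf.expectation p f < f x" for x by (simp add: not_le)
  have "measure_pmf.expectation p (\<lambda>_. measure_pmf.expectation p f) < measure_pmf.expectation p f"
  proof (rule measure_pmf.integral_less_AE_space)
    show "emeasure (measure_pmf p) (space (measure_pmf p)) \<noteq> 0"
      by (simp add: measure_pmf.emeasure_space_1 del: space_measure_pmf)
  qed (use less in \<open>auto intro!: integrable_measure_pmf_finite assms\<close>)
  then show False by simp
qed

text \<open>This is where the rate of the shared randomness is added to that of the index: a uniform
  block followed by a uniform word in it is a uniform word of the whole codebook.\<close>

lemma bind_pmf_of_set_Times:
  assumes "finite \<Omega>" "\<Omega> \<noteq> {}" "finite B" "B \<noteq> {}"
  shows "bind_pmf (pmf_of_set \<Omega>) (\<lambda>\<omega>. bind_pmf (pmf_of_set ({\<omega>} \<times> B)) f) = bind_pmf (pmf_of_set (\<Omega> \<times> B)) f"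
proof (rule pmf_eqI)
  fix z
  have "(\<Sum>k\<in>{\<omega>} \<times> B. pmf (f k) z) = (\<Sum>b\<in>B. pmf (f (\<omega>, b)) z)" for \<omega>
  proof -
    have "{\<omega>} \<times> B = Pair \<omega> ` B" by auto
    then show ?thesis by (simp add: sum.reindex inj_on_def)
  qed
  then show "pmf (bind_pmf (pmf_of_set \<Omega>) (\<lambda>\<omega>. bind_pmf (pmf_of_set ({\<omega>} \<times> B)) f)) z
      = pmf (bind_pmf (pmf_of_set (\<Omega> \<times> B)) f) z"
    using assms by (simp add: pmf_bind_pmf_of_set card_cartesian_product sum.cartesian_product
        sum_divide_distrib[symmetric] case_prod_beta')
qed

text \<open>\<open>KZ\<close> and \<open>h\<close> allow the output to be treated as a sequence of pairs, which has a product law, instead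
  of a pair of sequences.\<close>

lemma one_shot_simulation:
  fixes KX :: "'u \<Rightarrow> 'x pmf" and KE :: "'u \<Rightarrow> 'x \<Rightarrow> 'xt pmf" and W :: "'xt \<Rightarrow> 'yt pmf"
    and D :: "'yt \<Rightarrow> 'u \<Rightarrow> 'y pmf" and KT :: "'u \<Rightarrow> 'yt pmf" and KZ :: "'u \<Rightarrow> 'z pmf"
    and h :: "'z \<Rightarrow> 'x \<times> 'y" and \<Omega> :: "'w set"
  assumes fU: "finite (set_pmf pU)"
    and fin: "\<And>u. finite (set_pmf (KX u))" "\<And>u. finite (set_pmf (KT u))" "\<And>u. finite (set_pmf (KZ u))"
    and KT: "\<And>u. KT u = do {x \<leftarrow> KX u; xt \<leftarrow> KE u x; W xt}"
    and KZ: "\<And>u. map_pmf h (KZ u)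
      = do {x \<leftarrow> KX u; xt \<leftarrow> KE u x; yt \<leftarrow> W xt; y \<leftarrow> D yt u; return_pmf (x, y)}"
    and \<Omega>: "finite \<Omega>" "\<Omega> \<noteq> {}" and M: "M > 0" and \<gamma>: "\<gamma>1 > 0" "\<gamma>2 > 0" "\<gamma>3 > 0"
  shows "\<exists>(c :: 'w \<times> nat \<Rightarrow> 'u) g L. tv_dist
      (do {x \<leftarrow> bind_pmf pU KX; \<omega> \<leftarrow> pmf_of_set \<Omega>; xt \<leftarrow> bind_pmf (L x \<omega>) (\<lambda>k. KE (c k) x);
           yt \<leftarrow> W xt; y \<leftarrow> D yt (c (g yt \<omega>)); return_pmf (x, y)})
      (map_pmf h (bind_pmf pU KZ))
     \<le> (measure_pmf.prob (joint_pmf pU KX) {(u, x). pmf (KX u) x > \<gamma>1 * pmf (bind_pmf pU KX) x}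
          + sqrt (\<gamma>1 / M) / 2)
      + (measure_pmf.prob (joint_pmf pU KT) {(u, yt). pmf (KT u) yt \<le> \<gamma>3 * pmf (bind_pmf pU KT) yt}
          + M / \<gamma>3)
      + (measure_pmf.prob (joint_pmf pU KZ) {(u, z). pmf (KZ u) z > \<gamma>2 * pmf (bind_pmf pU KZ) z}
          + sqrt (\<gamma>2 / (card \<Omega> * M)) / 2)"
      (is "\<exists>c g L. ?t c g L \<le> ?b1 + ?b3 + ?b2")
proof -
  define B where "B = {..<M}"
  have B: "finite B" "B \<noteq> {}" "card B = M"
    using M by (auto simp: B_def)
  have N: "real (card \<Omega>) > 0"
    using \<Omega> by (simp add: card_gt_0_iff)
  let ?C = "Pi_pmf (\<Omega> \<times> B) undefined (\<lambda>_. pU)"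
  let ?E = "measure_pmf.expectation ?C"
  \<comment> \<open>The decoder knows \<open>\<omega>\<close>, so it searches only the block
    \<open>{\<omega>} \<times> B\<close>, where \<open>M\<close> words compete.\<close>
  define g where "g c yt \<omega> = (SOME k. k \<in> {\<omega>} \<times> B \<and> pmf (KT (c k)) yt > \<gamma>3 * pmf (bind_pmf pU KT) yt)"
    for c :: "'w \<times> nat \<Rightarrow> 'u" and yt and \<omega> :: 'w
  define s1 where "s1 c \<omega> = tv_dist (bind_pmf (pmf_of_set ({\<omega>} \<times> B)) (\<lambda>k. KX (c k))) (bind_pmf pU KX)"
    for c :: "'w \<times> nat \<Rightarrow> 'u" and \<omega>
  define s3 where "s3 c \<omega> = (\<Sum>k\<in>{\<omega>} \<times> B. measure_pmf.prob (KT (c k)) {yt. g c yt \<omega> \<noteq> k}) / card ({\<omega>} \<times> B)"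
    for c :: "'w \<times> nat \<Rightarrow> 'u" and \<omega>
  define s2 where "s2 c = tv_dist (bind_pmf (pmf_of_set (\<Omega> \<times> B)) (\<lambda>k. KZ (c k))) (bind_pmf pU KZ)"
    for c :: "'w \<times> nat \<Rightarrow> 'u"
  define s where "s c = (\<Sum>\<omega>\<in>\<Omega>. s1 c \<omega>) / card \<Omega> + (\<Sum>\<omega>\<in>\<Omega>. s3 c \<omega>) / card \<Omega> + s2 c" for c
  have fC: "finite (set_pmf ?C)"
    using \<Omega> B fU by (intro finite_set_Pi_pmf) auto
  have intC: "integrable (measure_pmf ?C) f" for f :: "_ \<Rightarrow> real"
    using fC by (rule integrable_measure_pmf_finite)
  have sub: "{\<omega>} \<times> B \<subseteq> \<Omega> \<times> B" if "\<omega> \<in> \<Omega>" for \<omega>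
    using that by auto
  \<comment> \<open>The same random codebook is used at two sizes: one block of \<open>M\<close>
    words for the source marginal and for decoding, all \<open>card \<Omega> * M\<close> words for
    the output pair.\<close>
  have e1: "?E (\<lambda>c. s1 c \<omega>) \<le> ?b1" if "\<omega> \<in> \<Omega>" for \<omega>
    using soft_covering[where K = KX, OF fU fin(1), where I' = "\<Omega> \<times> B" and I = "{\<omega>} \<times> B" and d = undefined and \<gamma> = \<gamma>1] \<Omega> B \<gamma> sub[OF that]
    by (simp add: s1_def card_cartesian_product)
  have e3: "?E (\<lambda>c. s3 c \<omega>) \<le> ?b3" if "\<omega> \<in> \<Omega>" for \<omega>
    using threshold_decoding[where K = KT, OF fU fin(2), where I' = "\<Omega> \<times> B" and I = "{\<omega>} \<times> B" and d = undefined and \<gamma> = \<gamma>3] \<Omega> B \<gamma> sub[OF that]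
    by (simp add: s3_def g_def card_cartesian_product)
  have e2: "?E s2 \<le> ?b2"
    using soft_covering[where K = KZ, OF fU fin(3), where I' = "\<Omega> \<times> B" and I = "\<Omega> \<times> B" and d = undefined and \<gamma> = \<gamma>2] \<Omega> B \<gamma>
    by (simp add: s2_def[abs_def] card_cartesian_product)
  have avg: "(\<Sum>\<omega>\<in>\<Omega>. a \<omega>) / card \<Omega> \<le> b" if "\<And>\<omega>. \<omega> \<in> \<Omega> \<Longrightarrow> a \<omega> \<le> b" for a and b :: real
    using sum_bounded_above[OF that] N by (simp add: pos_divide_le_eq mult.commute)
  have "?E s = (\<Sum>\<omega>\<in>\<Omega>. ?E (\<lambda>c. s1 c \<omega>)) / card \<Omega> + (\<Sum>\<omega>\<in>\<Omega>. ?E (\<lambda>c. s3 c \<omega>)) / card \<Omega> + ?E s2"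
    unfolding s_def[abs_def] using intC by (simp add: Bochner_Integration.integral_sum)
  also have "\<dots> \<le> ?b1 + ?b3 + ?b2"
    by (intro add_mono avg e1 e3 e2)
  finally obtain c where c: "s c \<le> ?b1 + ?b3 + ?b2"
    using exists_le_expectation[OF fC, of s] by (meson order_trans)
  obtain L where L: "tv_dist
      (do {x \<leftarrow> bind_pmf pU KX; \<omega> \<leftarrow> pmf_of_set \<Omega>; xt \<leftarrow> bind_pmf (L x \<omega>) (\<lambda>k. KE (c k) x);
           yt \<leftarrow> W xt; y \<leftarrow> D yt (c (g c yt \<omega>)); return_pmf (x, y)})
      (map_pmf h (bind_pmf pU KZ))
     \<le> (\<Sum>\<omega>\<in>\<Omega>. s1 c \<omega>) / card \<Omega> + (\<Sum>\<omega>\<in>\<Omega>. s3 c \<omega>) / card \<Omega>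
      + tv_dist (do {\<omega> \<leftarrow> pmf_of_set \<Omega>; k \<leftarrow> pmf_of_set ({\<omega>} \<times> B); map_pmf h (KZ (c k))})
          (map_pmf h (bind_pmf pU KZ))"
    unfolding s1_def s3_def KT KZ
    by (rule one_shot_code[OF \<Omega>, where I = "\<lambda>\<omega>. {\<omega>} \<times> B" and c = c and g = "g c" and KX = KX
          and KE = KE and W = W and D = D and pX = "bind_pmf pU KX" and T = "map_pmf h (bind_pmf pU KZ)"])
       (use B in auto)
  have "do {\<omega> \<leftarrow> pmf_of_set \<Omega>; k \<leftarrow> pmf_of_set ({\<omega>} \<times> B); map_pmf h (KZ (c k))}
      = map_pmf h (bind_pmf (pmf_of_set (\<Omega> \<times> B)) (\<lambda>k. KZ (c k)))"
    using \<Omega> B by (simp add: bind_pmf_of_set_Times map_bind_pmf)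
  then have "tv_dist (do {\<omega> \<leftarrow> pmf_of_set \<Omega>; k \<leftarrow> pmf_of_set ({\<omega>} \<times> B); map_pmf h (KZ (c k))})
          (map_pmf h (bind_pmf pU KZ)) \<le> s2 c"
    unfolding s2_def by (simp add: tv_dist_map)
  with L c have "?t c (g c) L \<le> ?b1 + ?b3 + ?b2"
    unfolding s_def by linarith
  then show ?thesis by blast
qed

text \<open>The law of \<open>(u, x, xt)\<close> is disintegrated over \<open>u\<close> and then
  over \<open>x\<close>. The remaining draws depend only on \<open>xt\<close>, \<open>yt\<close> and
  \<open>u\<close>, so they carry over unchanged.\<close>

lemma factor_through_aux:
  fixes pX :: "'x pmf" and pUXt :: "'x \<Rightarrow> ('u \<times> 'xt) pmf"
  obtains pU KX KE where "aux_pmf pX pUXt W pY =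
    do {u \<leftarrow> pU; x \<leftarrow> KX u; xt \<leftarrow> KE u x; yt \<leftarrow> W xt; y \<leftarrow> pY yt u; return_pmf (u, xt, yt, x, y)}"
proof -
  define J where "J = do {x \<leftarrow> pX; (u, xt) \<leftarrow> pUXt x; return_pmf (u, x, xt)}"
  obtain L where L: "J = joint_pmf (map_pmf fst J) L"
    by (rule disintegration)
  have "\<exists>K. L u = joint_pmf (map_pmf fst (L u)) K" for u
    using disintegration[of "L u"] by metis
  then obtain KE where KE: "\<And>u. L u = joint_pmf (map_pmf fst (L u)) (KE u)"
    by metis
  have "aux_pmf pX pUXt W pY
      = do {(u, x, xt) \<leftarrow> J; yt \<leftarrow> W xt; y \<leftarrow> pY yt u; return_pmf (u, xt, yt, x, y)}"
    by (simp add: aux_pmf_def J_def bind_assoc_pmf bind_return_pmf case_prod_beta')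
  also have "\<dots> = do {u \<leftarrow> map_pmf fst J; (x, xt) \<leftarrow> L u; yt \<leftarrow> W xt; y \<leftarrow> pY yt u; return_pmf (u, xt, yt, x, y)}"
    by (subst L) (simp add: joint_pmf_def bind_assoc_pmf bind_return_pmf case_prod_beta')
  also have "\<dots> = do {u \<leftarrow> map_pmf fst J; x \<leftarrow> map_pmf fst (L u); xt \<leftarrow> KE u x; yt \<leftarrow> W xt; y \<leftarrow> pY yt u;
      return_pmf (u, xt, yt, x, y)}"
    by (subst KE) (simp add: joint_pmf_def bind_assoc_pmf bind_return_pmf)
  finally show thesis by (rule that)
qed

lemma powr_real_tendsto_0: "a < 0 \<Longrightarrow> (\<lambda>n. 2 powr (real n * a)) \<longlonglongrightarrow> 0"
proof -
  assume "a < 0"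
  then have "(\<lambda>n. (2 powr a) ^ n) \<longlonglongrightarrow> (0 :: real)"
    by (intro LIMSEQ_realpow_zero) (auto simp: powr_less_one)
  then show ?thesis by (simp add: powr_power mult.commute)
qed

lemma set_Pi_pmf_subset_seqs: "set_pmf (Pi_pmf {..<n} undefined p) \<subseteq> seqs n"
  using set_Pi_pmf_subset[of "{..<n}" undefined p] by (auto simp: seqs_def PiE_def extensional_def)

lemma finite_set_memoryless: "finite (set_pmf (memoryless n K u))" for K :: "'a \<Rightarrow> 'b::finite pmf"
  unfolding memoryless_def by (intro finite_set_Pi_pmf) auto

text \<open>The one-shot bound applied to n-fold kernels: products commute with
  \<open>bind_pmf\<close>, so the required relations between the kernels pass from letters to
  blocks. The thresholds and \<open>M\<close> stay free, to be chosen for each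
  \<open>n\<close>.\<close>

lemma avg_sim_code_exists:
  fixes pU :: "'u::finite pmf" and KX :: "'u \<Rightarrow> 'x::finite pmf" and KE :: "'u \<Rightarrow> 'x \<Rightarrow> 'xt::finite pmf"
    and W :: "'xt \<Rightarrow> 'yt::finite pmf" and D :: "'yt \<Rightarrow> 'u \<Rightarrow> 'y::finite pmf"
    and V :: "'x \<Rightarrow> 'y pmf"
  defines "KT \<equiv> \<lambda>u. do {x \<leftarrow> KX u; xt \<leftarrow> KE u x; W xt}"
    and "KZ \<equiv> \<lambda>u. do {x \<leftarrow> KX u; xt \<leftarrow> KE u x; yt \<leftarrow> W xt; y \<leftarrow> D yt u; return_pmf (x, y)}"
  assumes V: "bind_pmf pU KZ = joint_pmf pX V"
    and R: "R \<ge> 0" and M: "M > 0" and \<gamma>: "\<gamma>1 > 0" "\<gamma>2 > 0" "\<gamma>3 > 0"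
  shows "\<exists>enc dec. avg_sim_code pX V W n R
      ((measure_pmf.prob (joint_pmf (iid_pmf n pU) (memoryless n KX)) {(u, x).
          pmf (memoryless n KX u) x > \<gamma>1 * pmf (bind_pmf (iid_pmf n pU) (memoryless n KX)) x}
          + sqrt (\<gamma>1 / M) / 2)
      + (measure_pmf.prob (joint_pmf (iid_pmf n pU) (memoryless n KT)) {(u, yt).
          pmf (memoryless n KT u) yt \<le> \<gamma>3 * pmf (bind_pmf (iid_pmf n pU) (memoryless n KT)) yt}
          + M / \<gamma>3)
      + (measure_pmf.prob (joint_pmf (iid_pmf n pU) (memoryless n KZ)) {(u, z).
          pmf (memoryless n KZ u) z > \<gamma>2 * pmf (bind_pmf (iid_pmf n pU) (memoryless n KZ)) z}
          + sqrt (\<gamma>2 / (card (rand_range n R) * M)) / 2)) enc dec"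
    (is "\<exists>enc dec. avg_sim_code pX V W n R ?e enc dec")
proof -
  define KE' where "KE' u x = Pi_pmf {..<n} undefined (\<lambda>i. KE (u i) (x i))" for u x
  define D' where "D' yt u = Pi_pmf {..<n} undefined (\<lambda>i. D (yt i) (u i))" for yt u
  have KT': "memoryless n KT u = do {x \<leftarrow> memoryless n KX u; xt \<leftarrow> KE' u x; memoryless n W xt}" for u
    unfolding memoryless_def KT_def KE'_def by (simp add: Pi_pmf_bind[where d' = undefined])
  \<comment> \<open>In this form the n-fold product of \<open>KZ u\<close>, a sequence of pairs, can
    be unzipped by \<open>joint_pmf_Pi_pmf\<close>.\<close>
  have KZ_joint: "KZ u = joint_pmf (KX u) (\<lambda>x. do {xt \<leftarrow> KE u x; yt \<leftarrow> W xt; D yt u})" for u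
    by (simp add: KZ_def joint_pmf_def bind_assoc_pmf)
  have "map_pmf (unzip_seq n) (memoryless n KZ u)
    = joint_pmf (memoryless n KX u) (\<lambda>x. do {xt \<leftarrow> KE' u x; yt \<leftarrow> memoryless n W xt; D' yt u})" for u
    unfolding memoryless_def KZ_joint joint_pmf_Pi_pmf[symmetric] KE'_def D'_def
    by (simp add: Pi_pmf_bind[where d' = undefined])
  then have KZ': "map_pmf (unzip_seq n) (memoryless n KZ u) = do {x \<leftarrow> memoryless n KX u; xt \<leftarrow> KE' u x;
      yt \<leftarrow> memoryless n W xt; y \<leftarrow> D' yt u; return_pmf (x, y)}" for u
    by (simp add: joint_pmf_def bind_assoc_pmf)
  have pX: "bind_pmf pU KX = pX"
  proof -
    have "map_pmf fst (bind_pmf pU KZ) = bind_pmf pU KX"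
      by (simp add: map_bind_pmf KZ_joint map_fst_joint_pmf)
    then show ?thesis by (simp add: V map_fst_joint_pmf)
  qed
  have target: "map_pmf (unzip_seq n) (bind_pmf (iid_pmf n pU) (memoryless n KZ))
      = joint_pmf (iid_pmf n pX) (memoryless n V)"
    by (simp add: bind_iid_memoryless V joint_pmf_iid_memoryless)
  \<comment> \<open>With \<open>R \<ge> 0\<close> rounding down leaves at least one value of the
    shared randomness.\<close>
  have "2 powr (real n * R) \<ge> 1"
    using R by (simp add: ge_one_powr_ge_zero)
  then have \<Omega>: "finite (rand_range n R)" "rand_range n R \<noteq> {}"
    by (auto simp: rand_range_def le_nat_iff le_floor_iff)
  have fU: "finite (set_pmf (iid_pmf n pU))"
    unfolding iid_pmf_def by (intro finite_set_Pi_pmf) auto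
  obtain c :: "nat \<times> nat \<Rightarrow> nat \<Rightarrow> 'u" and g L where c: "tv_dist
      (do {x \<leftarrow> bind_pmf (iid_pmf n pU) (memoryless n KX); \<omega> \<leftarrow> pmf_of_set (rand_range n R);
           xt \<leftarrow> bind_pmf (L x \<omega>) (\<lambda>k. KE' (c k) x);
           yt \<leftarrow> memoryless n W xt; y \<leftarrow> D' yt (c (g yt \<omega>)); return_pmf (x, y)})
      (map_pmf (unzip_seq n) (bind_pmf (iid_pmf n pU) (memoryless n KZ))) \<le> ?e"
    using one_shot_simulation[where KX = "memoryless n KX" and KT = "memoryless n KT" and KZ = "memoryless n KZ", OF fU finite_set_memoryless finite_set_memoryless finite_set_memoryless
      KT' KZ' \<Omega> M \<gamma>] by blast
  define enc where "enc x \<omega> = bind_pmf (L x \<omega>) (\<lambda>k. KE' (c k) x)" for x \<omega>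
  define dec where "dec yt \<omega> = D' yt (c (g yt \<omega>))" for yt \<omega>
  have "simulated_pmf n R pX W enc dec
      = do {x \<leftarrow> bind_pmf (iid_pmf n pU) (memoryless n KX); \<omega> \<leftarrow> pmf_of_set (rand_range n R);
           xt \<leftarrow> bind_pmf (L x \<omega>) (\<lambda>k. KE' (c k) x);
           yt \<leftarrow> memoryless n W xt; y \<leftarrow> D' yt (c (g yt \<omega>)); return_pmf (x, y)}"
    by (simp add: simulated_pmf_def enc_def dec_def bind_iid_memoryless pX)
  then have "tv_dist (simulated_pmf n R pX W enc dec) (joint_pmf (iid_pmf n pX) (memoryless n V)) \<le> ?e"
    using c by (simp only: target)
  moreover have "set_pmf (enc x \<omega>) \<subseteq> seqs n" "set_pmf (dec yt \<omega>) \<subseteq> seqs n" for x yt \<omega>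
    using set_Pi_pmf_subset_seqs by (auto simp: enc_def dec_def KE'_def D'_def)
  ultimately have "avg_sim_code pX V W n R ?e enc dec"
    unfolding avg_sim_code_def by blast
  then show ?thesis by blast
qed

theorem theorem4:
  fixes pX :: "'x::finite pmf"
    and V :: "'x \<Rightarrow> 'y::finite pmf"
    and W :: "'xt::finite \<Rightarrow> 'yt::finite pmf"
    and R :: real
  assumes "R \<ge> 0"
    and "\<exists>(pUXt :: 'x \<Rightarrow> ('u::finite \<times> 'xt) pmf) (pY :: 'yt \<Rightarrow> 'u \<Rightarrow> 'y pmf).
      let J = aux_pmf pX pUXt W pY;
          U = (\<lambda>(u, xt, yt, x, y). u);
          Yt = (\<lambda>(u, xt, yt, x, y). yt);
          X = (\<lambda>(u, xt, yt, x, y). x);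
          XY = (\<lambda>(u, xt, yt, x, y). (x, y))
      in map_pmf XY J = joint_pmf pX V \<and>
         R + mutual_info J U Yt > mutual_info J U XY \<and>
         mutual_info J U Yt > mutual_info J U X"
  shows "avg_admissible pX V W R"
proof -
  define U Yt X XY where
    "U = (\<lambda>(u, xt :: 'xt, yt :: 'yt, x :: 'x, y :: 'y). u :: 'u)" and "Yt = (\<lambda>(u :: 'u, xt :: 'xt, yt, x :: 'x, y :: 'y). yt :: 'yt)" and
    "X = (\<lambda>(u :: 'u, xt :: 'xt, yt :: 'yt, x, y :: 'y). x :: 'x)" and
    "XY = (\<lambda>(u :: 'u, xt :: 'xt, yt :: 'yt, x, y). (x :: 'x, y :: 'y))"
  obtain pUXt :: "'x \<Rightarrow> ('u \<times> 'xt) pmf" and pY :: "'yt \<Rightarrow> 'u \<Rightarrow> 'y pmf" where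
    *: "map_pmf XY (aux_pmf pX pUXt W pY) = joint_pmf pX V"
      "R + mutual_info (aux_pmf pX pUXt W pY) U Yt > mutual_info (aux_pmf pX pUXt W pY) U XY"
      "mutual_info (aux_pmf pX pUXt W pY) U Yt > mutual_info (aux_pmf pX pUXt W pY) U X"
    using assms(2) unfolding Let_def U_def Yt_def X_def XY_def by blast
  define J where "J = aux_pmf pX pUXt W pY"
  obtain pU KX KE where J: "J =
    do {u \<leftarrow> pU; x \<leftarrow> KX u; xt \<leftarrow> KE u x; yt \<leftarrow> W xt; y \<leftarrow> pY yt u; return_pmf (u, xt, yt, x, y)}"
    unfolding J_def by (rule factor_through_aux)
  define KT where "KT = (\<lambda>u. do {x \<leftarrow> KX u; xt \<leftarrow> KE u x; W xt})"
  define KZ where "KZ = (\<lambda>u. do {x \<leftarrow> KX u; xt \<leftarrow> KE u x; yt \<leftarrow> W xt; y \<leftarrow> pY yt u; return_pmf (x, y)})"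
  let ?I = "\<lambda>K. measure_pmf.expectation (joint_pmf pU K) (info_density pU K)"
  have "map_pmf (\<lambda>s. (U s, X s)) J = joint_pmf pU KX"
    by (simp add: J joint_pmf_def map_bind_pmf U_def X_def)
  then have IX: "mutual_info J U X = ?I KX"
    by (rule mutual_info_conv_info_density)
  have "map_pmf (\<lambda>s. (U s, Yt s)) J = joint_pmf pU KT"
    by (simp add: J joint_pmf_def map_bind_pmf bind_assoc_pmf U_def Yt_def KT_def)
  then have IT: "mutual_info J U Yt = ?I KT"
    by (rule mutual_info_conv_info_density)
  have "map_pmf (\<lambda>s. (U s, XY s)) J = joint_pmf pU KZ"
    by (simp add: J joint_pmf_def map_bind_pmf bind_assoc_pmf bind_return_pmf U_def XY_def KZ_def)
  then have IZ: "mutual_info J U XY = ?I KZ"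
    by (rule mutual_info_conv_info_density)
  have V: "bind_pmf pU KZ = joint_pmf pX V"
    unfolding *(1)[symmetric] J_def[symmetric]
    by (simp add: J map_bind_pmf bind_assoc_pmf XY_def KZ_def)
  have "0 \<le> ?I KX"
    unfolding IX[symmetric] by (rule mutual_info_nonneg)
  \<comment> \<open>\<open>a\<close> collects the two lower constraints on \<open>R'\<close>; the
    hypotheses place it below \<open>?I KT\<close>, and \<open>R'\<close> is the midpoint. Since
    \<open>?I KX\<close> is non-negative, \<open>R'\<close> is positive.\<close>
  define a where "a = max (?I KX) (?I KZ - R)"
  have a: "?I KX \<le> a" "?I KZ - R \<le> a" "a < ?I KT"
    using *(2,3) unfolding J_def[symmetric] IX IT IZ a_def by simp_all
  define R' where "R' = (a + ?I KT) / 2"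
  have "iX < (a + iT) / 2 \<and> iZ < R + (a + iT) / 2 \<and> (a + iT) / 2 < iT \<and> (a + iT) / 2 > 0"
    if "0 \<le> iX" "iX \<le> a" "iZ - R \<le> a" "a < iT" for iX iZ iT
    using that by (auto simp: field_simps)
  from this[OF \<open>0 \<le> ?I KX\<close> a] have R': "?I KX < R'" "?I KZ < R + R'" "R' < ?I KT" "R' > 0"
    unfolding R'_def by blast+
  \<comment> \<open>Each exponent is the midpoint of an information and a rate. The gap to the
    information drives the weak law, the gap to the rate the exponential decay. Covering wants many
    words, so \<open>r1\<close> and \<open>r2\<close> lie below their rates; decoding wants few, so
    \<open>r3\<close> lies above \<open>R'\<close>.\<close>
  define r1 r2 r3 where "r1 = (?I KX + R') / 2" and "r2 = (?I KZ + (R + R')) / 2" and "r3 = (R' + ?I KT) / 2"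
  have r: "?I KX < r1" "r1 < R'" "?I KZ < r2" "r2 < R + R'" "R' < r3" "r3 < ?I KT"
    using R' by (auto simp: r1_def r2_def r3_def)
  \<comment> \<open>Rounding up gives covering its lower bound. As \<open>R' > 0\<close>, the
    rounded number is at least 1, so it at most doubles, which costs decoding a factor 2.\<close>
  define M where "M n = nat \<lceil>2 powr (real n * R')\<rceil>" for n :: nat
  define b1 where "b1 n = measure_pmf.prob (joint_pmf (iid_pmf n pU) (memoryless n KX)) {(u, x).
      pmf (memoryless n KX u) x > 2 powr (real n * r1) * pmf (bind_pmf (iid_pmf n pU) (memoryless n KX)) x}" for n
  define b2 where "b2 n = measure_pmf.prob (joint_pmf (iid_pmf n pU) (memoryless n KZ)) {(u, z).
      pmf (memoryless n KZ u) z > 2 powr (real n * r2) * pmf (bind_pmf (iid_pmf n pU) (memoryless n KZ)) z}" for n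
  define b3 where "b3 n = measure_pmf.prob (joint_pmf (iid_pmf n pU) (memoryless n KT)) {(u, yt).
      pmf (memoryless n KT u) yt \<le> 2 powr (real n * r3) * pmf (bind_pmf (iid_pmf n pU) (memoryless n KT)) yt}" for n
  define \<epsilon> where "\<epsilon> n = (b1 n + sqrt (2 powr (real n * r1) / M n) / 2) + (b3 n + M n / 2 powr (real n * r3))
      + (b2 n + sqrt (2 powr (real n * r2) / (card (rand_range n R) * M n)) / 2)" for n
  have M: "M n > 0" "M n \<ge> 2 powr (real n * R')" "M n \<le> 2 * 2 powr (real n * R')" for n
  proof -
    have "2 powr (real n * R') \<ge> 1"
      using R' by (simp add: ge_one_powr_ge_zero)
    then show "M n > 0" "M n \<ge> 2 powr (real n * R')" "M n \<le> 2 * 2 powr (real n * R')"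
      unfolding M_def by - linarith+
  qed
  \<comment> \<open>Rounding down a number that is at least 1 loses at most half of it, hence the
    factor 2 in the covering term for the pair.\<close>
  have \<Omega>: "card (rand_range n R) \<ge> 2 powr (real n * R) / 2" for n
  proof -
    have "2 powr (real n * R) \<ge> 1"
      using assms(1) by (simp add: ge_one_powr_ge_zero)
    then have "\<lfloor>2 powr (real n * R)\<rfloor> \<ge> 1" by simp
    then have "2 powr (real n * R) / 2 \<le> real (nat \<lfloor>2 powr (real n * R)\<rfloor>)"
      by linarith
    then show ?thesis
      by (simp add: rand_range_def)
  qed
  have "b1 \<longlonglongrightarrow> 0" "b2 \<longlonglongrightarrow> 0" "b3 \<longlonglongrightarrow> 0"
    unfolding b1_def[abs_def] b2_def[abs_def] b3_def[abs_def]
    by (intro prob_info_density_above prob_info_density_below r)+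
  moreover have "(\<lambda>n. 2 powr (real n * r1) / M n) \<longlonglongrightarrow> 0"
  proof (rule tendsto_sandwich[OF _ _ tendsto_const powr_real_tendsto_0[of "r1 - R'"]])
    show "\<forall>\<^sub>F n in sequentially. 2 powr (real n * r1) / M n \<le> 2 powr (real n * (r1 - R'))"
    proof (intro always_eventually allI)
      fix n
      have "2 powr (real n * r1) / M n \<le> 2 powr (real n * r1) / 2 powr (real n * R')"
        using M[of n] by (intro divide_left_mono) auto
      then show "2 powr (real n * r1) / M n \<le> 2 powr (real n * (r1 - R'))"
        by (simp add: powr_diff right_diff_distrib)
    qed
  qed (use r in auto)
  moreover have "(\<lambda>n. M n / 2 powr (real n * r3)) \<longlonglongrightarrow> 0"
  proof (rule tendsto_sandwich[OF _ _ tendsto_const tendsto_mult_right_zero[OF powr_real_tendsto_0[of "R' - r3"], of 2]])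
    show "\<forall>\<^sub>F n in sequentially. M n / 2 powr (real n * r3) \<le> 2 * 2 powr (real n * (R' - r3))"
    proof (intro always_eventually allI)
      fix n
      have "M n / 2 powr (real n * r3) \<le> (2 * 2 powr (real n * R')) / 2 powr (real n * r3)"
        using M[of n] by (intro divide_right_mono) auto
      then show "M n / 2 powr (real n * r3) \<le> 2 * 2 powr (real n * (R' - r3))"
        by (simp add: powr_diff right_diff_distrib)
    qed
  qed (use r in auto)
  moreover have "(\<lambda>n. 2 powr (real n * r2) / (card (rand_range n R) * M n)) \<longlonglongrightarrow> 0"
  proof (rule tendsto_sandwich[OF _ _ tendsto_const tendsto_mult_right_zero[OF powr_real_tendsto_0[of "r2 - (R + R')"], of 2]])
    show "\<forall>\<^sub>F n in sequentially. 2 powr (real n * r2) / (card (rand_range n R) * M n)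
        \<le> 2 * 2 powr (real n * (r2 - (R + R')))"
    proof (intro always_eventually allI)
      fix n
      have pos: "2 powr (real n * R) / 2 * 2 powr (real n * R') > 0" by simp
      have "2 powr (real n * R) / 2 * 2 powr (real n * R') \<le> real (card (rand_range n R)) * real (M n)"
        using M[of n] \<Omega>[of n] by (intro mult_mono) auto
      then have "2 powr (real n * r2) / (card (rand_range n R) * M n)
          \<le> 2 powr (real n * r2) / (2 powr (real n * R) / 2 * 2 powr (real n * R'))"
        unfolding of_nat_mult by (intro frac_le) (use pos in auto)
      also have "\<dots> = 2 * 2 powr (real n * (r2 - (R + R')))"
        by (simp add: powr_diff powr_add right_diff_distrib distrib_left)
      finally show "2 powr (real n * r2) / (card (rand_range n R) * M n)
        \<le> 2 * 2 powr (real n * (r2 - (R + R')))" .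
    qed
  qed (use r in auto)
  ultimately have "\<epsilon> \<longlonglongrightarrow> (0 + sqrt 0 / 2) + (0 + 0) + (0 + sqrt 0 / 2)"
    unfolding \<epsilon>_def[abs_def] by (intro tendsto_add tendsto_divide tendsto_real_sqrt tendsto_const) auto
  then have "\<epsilon> \<longlonglongrightarrow> 0" by simp
  moreover have "\<exists>enc dec. avg_sim_code pX V W n R (\<epsilon> n) enc dec" for n
    unfolding \<epsilon>_def b1_def b2_def b3_def KT_def KZ_def
    by (rule avg_sim_code_exists[OF V[unfolded KZ_def] assms(1) M(1)]) simp_all
  then obtain enc dec where "\<And>n. avg_sim_code pX V W n R (\<epsilon> n) (enc n) (dec n)"
    by metis
  ultimately show ?thesis
    unfolding avg_admissible_def by blast
qed

end
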